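(* Let $(X,f_\infty)$ be a topological NDS with stationary state space $(X,d)$ and let $\mu_\infty$ be an IMS for it. Then, under each of the following conditions, there exists a fine-scale sequence $(\mathcal{P}^k_\infty)_{k=0}^\infty$ in $\mathcal{E}_{\mathrm M}(\mu_\infty)$ such that every $\mathcal{P}^k_\infty$ is a constant sequence of partitions (i.e. for each $k$ there is a partition $\mathcal{P}^k$ of $X$ with $\mathcal{P}^k_n=\mathcal{P}^k$ for all $n\ge0$). (i) The set $\{\mu_n\}_{n=0}^\infty$ is relatively compact in the strong topology on the space of measures. (ii) For every $\alpha>0$ there is a finite measurable partition $\mathcal{P}$ of $X$ with $\operatorname{diam}P<\alpha$ for all $P\in\mathcal P$ (that is, $\operatorname{diam}\mathcal{P}<\alpha$) such that every $P\in\mathcal{P}$ satisfies $\nu(\partial P)=0$ for all $\nu\in\mathcal{W}(\mu_\infty)$. (iii) The space $X$ is zero-dimensional. (iv) $X=[0,1]$ or $X=\mathrm{S}^1$ (the circle), and there exists a dense set $D\subset X$ such that every $x\in D$ satisfies $\nu(\{x\})=0$ for all $\nu\in\mathcal{W}(\mu_\infty)$.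
   Context: A topological NDS with stationary state space, $(X,f_\infty)$, consists of a nonempty compact metric space $(X,d)$ and an equicontinuous sequence $f_\infty=(f_n)_{n\ge0}$ of maps $f_n:X\to X$ (for every $\varepsilon>0$ there is $\delta>0$ such that for all $n$ and $x,y\in X$, $d(x,y)<\delta$ implies $d(f_n(x),f_n(y))<\varepsilon$). An invariant measure sequence (IMS) is a sequence $\mu_\infty=(\mu_n)_{n\ge0}$ of Borel probability measures on $X$ with $f_n\mu_n=\mu_{n+1}$ (push-forward) for all $n$. $\mathcal{W}(\mu_\infty)$ denotes the set of all weak$^*$ limit points of the sequence $\mu_\infty$. $\mathcal{E}_{\mathrm M}(\mu_\infty)$ is the family of admissible sequences: a sequence $\mathcal{P}_\infty=(\mathcal{P}_n)_{n\ge0}$ of finite Borel partitions $\mathcal{P}_n=\{P_{n,1},\dots,P_{n,k_n}\}$ of $X$ is in $\mathcal{E}_{\mathrm M}(\mu_\infty)$ iff $(k_n)$ is bounded and for each $\varepsilon>0$ there are $\delta>0$ and compact (possibly empty) sets $K_{n,i}\subset P_{n,i}$ such that for all $n\ge0$: (a) $\mu_n(P_{n,i}\setminus K_{n,i})\le\varepsilon$ for $i=1,\dots,k_n$; (b) for $1\le i<j\le k_n$, $d(x,y)\ge\delta$ for all $x\in K_{n,i}$, $y\in K_{n,j}$. $\operatorname{diam}\mathcal{P}_\infty:=\sup_{n\ge0}\sup_{P\in\mathcal{P}_n}\operatorname{diam}P$. A sequence $(\mathcal{P}^k_\infty)_{k\ge0}$ in $\mathcal{E}_{\mathrm M}(\mu_\infty)$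 is a fine-scale sequence if $\operatorname{diam}\mathcal{P}^k_\infty\to0$ as $k\to\infty$. The strong topology on the space of measures is the topology of setwise convergence, i.e. the coarsest topology making all evaluations $\mu\mapsto\mu(A)$, $A$ Borel, continuous. $[0,1]$ and $\mathrm{S}^1$ carry their standard metrics. A compact metric space is zero-dimensional if its topology has a base of clopen sets. *)

theory Defs
  imports "HOL-Probability.Probability"
begin

text \<open>The state space is a subset \<open>X\<close> of a type of class \<open>metric_space\<close>, with the restricted metric
  \<^const>\<open>dist\<close>, topology \<^term>\<open>top_of_set X\<close> and Borel \<open>\<sigma>\<close>-algebra
  \<^term>\<open>restrict_space borel X\<close>.\<close>

definition topological_NDS :: "'a::metric_space set \<Rightarrow> (nat \<Rightarrow> 'a \<Rightarrow> 'a) \<Rightarrow> bool" where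
  "topological_NDS X f \<longleftrightarrow>
     compact X \<and> X \<noteq> {} \<and> (\<forall>n. f n ` X \<subseteq> X) \<and>
     (\<forall>\<epsilon>>0. \<exists>\<delta>>0. \<forall>n. \<forall>x\<in>X. \<forall>y\<in>X. dist x y < \<delta> \<longrightarrow> dist (f n x) (f n y) < \<epsilon>)"

definition borel_probs :: "'a::metric_space set \<Rightarrow> 'a measure set" where
  "borel_probs X = {\<mu>. prob_space \<mu> \<and> sets \<mu> = sets (restrict_space borel X)}"

definition IMS :: "'a::metric_space set \<Rightarrow> (nat \<Rightarrow> 'a \<Rightarrow> 'a) \<Rightarrow> (nat \<Rightarrow> 'a measure) \<Rightarrow> bool" where
  "IMS X f \<mu> \<longleftrightarrow>
     (\<forall>n. \<mu> n \<in> borel_probs X) \<and>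
     (\<forall>n. distr (\<mu> n) (restrict_space borel X) (f n) = \<mu> (Suc n))"

text \<open>The coarsest topology on \<open>S\<close> making every function in \<open>F\<close> continuous. Its carrier is \<open>S\<close> as
  soon as \<open>F\<close> is nonempty.\<close>

definition initial_topology :: "'m set \<Rightarrow> ('m \<Rightarrow> real) set \<Rightarrow> 'm topology" where
  "initial_topology S F = topology_generated_by {{m \<in> S. \<phi> m \<in> U} | \<phi> U. \<phi> \<in> F \<and> open U}"

definition strong_topology :: "'a::metric_space set \<Rightarrow> 'a measure topology" where
  "strong_topology X =
     initial_topology (borel_probs X) {\<lambda>\<mu>. measure \<mu> A | A. A \<in> sets (restrict_space borel X)}"

definition weak_star_topology :: "'a::metric_space set \<Rightarrow> 'a measure topology" where
  "weak_star_topology X =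
     initial_topology (borel_probs X) {\<lambda>\<mu>. LINT x|\<mu>. \<phi> x | \<phi> :: 'a \<Rightarrow> real. continuous_on X \<phi>}"

definition relatively_compact_in :: "'m topology \<Rightarrow> 'm set \<Rightarrow> bool" where
  "relatively_compact_in T S \<longleftrightarrow> S \<subseteq> topspace T \<and> compactin T (T closure_of S)"

text \<open>Limit points of the sequence, not of its range: a value taken infinitely often counts.\<close>

definition limit_points_seq :: "'m topology \<Rightarrow> (nat \<Rightarrow> 'm) \<Rightarrow> 'm set" where
  "limit_points_seq T s =
     {l \<in> topspace T. \<forall>U. openin T U \<and> l \<in> U \<longrightarrow> (\<exists>\<^sub>F n in sequentially. s n \<in> U)}"

definition weak_limits :: "'a::metric_space set \<Rightarrow> (nat \<Rightarrow> 'a measure) \<Rightarrow> 'a measure set" where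
  "weak_limits X \<mu> = limit_points_seq (weak_star_topology X) \<mu>"

definition finite_borel_partition :: "'a::metric_space set \<Rightarrow> 'a set set \<Rightarrow> bool" where
  "finite_borel_partition X Q \<longleftrightarrow>
     finite Q \<and> partition_on X Q \<and> Q \<subseteq> sets (restrict_space borel X)"

text \<open>The compact sets \<open>K n A\<close> are indexed by the partition elements \<open>A \<in> P n\<close> themselves.\<close>

definition admissible ::
  "'a::metric_space set \<Rightarrow> (nat \<Rightarrow> 'a measure) \<Rightarrow> (nat \<Rightarrow> 'a set set) set" where
  "admissible X \<mu> =
     {P. (\<forall>n. finite_borel_partition X (P n)) \<and>
         (\<exists>N. \<forall>n. card (P n) \<le> N) \<and>
         (\<forall>\<epsilon>>0. \<exists>\<delta>>0. \<exists>K :: nat \<Rightarrow> 'a set \<Rightarrow> 'a set. \<forall>n.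
            (\<forall>A\<in>P n. compact (K n A) \<and> K n A \<subseteq> A \<and> measure (\<mu> n) (A - K n A) \<le> \<epsilon>) \<and>
            (\<forall>A\<in>P n. \<forall>B\<in>P n. A \<noteq> B \<longrightarrow> (\<forall>x\<in>K n A. \<forall>y\<in>K n B. \<delta> \<le> dist x y)))}"

definition diam_seq :: "(nat \<Rightarrow> 'a::metric_space set set) \<Rightarrow> real" where
  "diam_seq P = (SUP n. SUP A\<in>P n. diameter A)"

definition fine_scale_sequence ::
  "'a::metric_space set \<Rightarrow> (nat \<Rightarrow> 'a measure) \<Rightarrow> (nat \<Rightarrow> nat \<Rightarrow> 'a set set) \<Rightarrow> bool" where
  "fine_scale_sequence X \<mu> P \<longleftrightarrow>
     (\<forall>k. P k \<in> admissible X \<mu>) \<and> (\<lambda>k. diam_seq (P k)) \<longlonglongrightarrow> 0"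

definition zero_dimensional :: "'a topology \<Rightarrow> bool" where
  "zero_dimensional T \<longleftrightarrow>
     (\<exists>\<B>. (\<forall>U\<in>\<B>. openin T U \<and> closedin T U) \<and> openin T = arbitrary union_of (\<lambda>U. U \<in> \<B>))"

text \<open>Since \<open>X\<close> lives in an arbitrary metric space, ``\<open>X = [0,1]\<close>'' and ``\<open>X = S\<^sup>1\<close>'' are read as
  equality up to isometry.\<close>

definition isometric ::
  "'a set \<Rightarrow> ('a \<Rightarrow> 'a \<Rightarrow> real) \<Rightarrow> 'b set \<Rightarrow> ('b \<Rightarrow> 'b \<Rightarrow> real) \<Rightarrow> bool" where
  "isometric X d Y e \<longleftrightarrow>
     (\<exists>g. bij_betw g X Y \<and> (\<forall>x\<in>X. \<forall>y\<in>X. e (g x) (g y) = d x y))"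

text \<open>The usual metrics on the unit circle: chordal, arc length, and arc length normalized to total
  length \<open>1\<close> (the quotient metric of \<open>\<real>/\<int>\<close>).\<close>

definition circle_metrics :: "(complex \<Rightarrow> complex \<Rightarrow> real) set" where
  "circle_metrics =
     {dist, \<lambda>z w. \<bar>Arg (z / w)\<bar>, \<lambda>z w. \<bar>Arg (z / w)\<bar> / (2 * pi)}"

definition unit_interval_space :: "'a::metric_space set \<Rightarrow> bool" where
  "unit_interval_space X \<longleftrightarrow> isometric X dist {0..1::real} dist"

definition circle_space :: "'a::metric_space set \<Rightarrow> bool" where
  "circle_space X \<longleftrightarrow> (\<exists>e\<in>circle_metrics. isometric X dist (sphere (0::complex) 1) e)"

end

theory Submission
  imports Defs
begin

text \<open>A constant sequence of partitions is admissible as soon as each cell \<open>A\<close> is inner regular uniformly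
  in \<open>n\<close>: for every \<open>\<epsilon>\<close> one compact \<open>K \<subseteq> A\<close> satisfies \<open>\<mu>\<^sub>n(A - K) \<le> \<epsilon>\<close> for all \<open>n\<close>.

  Under (i) every Borel set has this property: the sets \<open>{m. m(A - K\<^sub>\<nu>) < \<epsilon>}\<close>, with \<open>K\<^sub>\<nu>\<close> chosen by inner
  regularity of a single \<open>\<nu>\<close>, are an open cover of a compact set, and finitely many \<open>K\<^sub>\<nu>\<close> suffice.

  Under (ii), if the points of \<open>A\<close> at distance at least \<open>1/m\<close> from \<open>X - A\<close> failed for infinitely many \<open>n\<close>
  and every \<open>m\<close>, a weak* limit along those \<open>n\<close> would charge \<open>\<partial>A\<close>; the finitely many remaining \<open>n\<close>
  are dealt with by adding finitely many compact sets. Sequential compactness of the space of measures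
  is pulled back from Helly's theorem on the real line through a Borel injection \<open>X \<rightarrow> \<real>\<close> whose inverse
  is continuous on the closure of the image.

  Under (iii) and (iv) there are arbitrarily small open neighbourhoods with null frontier, and
  subtracting the members of a finite cover from one another reduces to (ii).\<close>

section \<open>Partitions and regularity of Borel measures\<close>

lemma diameter_leI:
  fixes S :: "'a::metric_space set"
  assumes "0 \<le> d" and "\<And>x y. x \<in> S \<Longrightarrow> y \<in> S \<Longrightarrow> dist x y \<le> d"
  shows "diameter S \<le> d"
proof (cases "S = {}")
  case False
  then show ?thesis
    unfolding diameter_def using assms(2) by (auto intro!: cSUP_least)
qed (use assms in simp)

text \<open>Induction over the cover: the new set \<open>U\<close> becomes a cell and is removed
  from the cells built so far, so all cells arise from members of \<open>F\<close> by taking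
  differences.\<close>

lemma partition_of_Union_in_ring:
  assumes "finite F" and "F \<subseteq> R" and Diff: "\<And>A B. A \<in> R \<Longrightarrow> B \<in> R \<Longrightarrow> A - B \<in> R"
  shows "\<exists>Q\<subseteq>R. finite Q \<and> partition_on (\<Union>F) Q"
  using assms(1,2)
proof (induction F rule: finite_induct)
  case empty
  then show ?case
    by (intro exI[of _ "{}"]) (auto simp: partition_on_def)
next
  case (insert U F)
  then obtain Q where Q: "Q \<subseteq> R" "finite Q" "partition_on (\<Union>F) Q" by auto
  let ?Q = "(insert U ((\<lambda>A. A - U) ` Q)) - {{}}"
  have "\<Union>?Q = \<Union>(insert U F)"
    using partition_onD1[OF Q(3)] by auto
  moreover have "disjoint ?Q"
  proof (rule disjointI)
    have disj: "A \<inter> B = {}" if "A \<in> Q" "B \<in> Q" "A \<noteq> B" for A B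
      using disjointD[OF partition_onD2[OF Q(3)]] that by blast
    fix A B assume "A \<in> ?Q" "B \<in> ?Q" "A \<noteq> B"
    then consider "A = U" "B \<in> (\<lambda>A. A - U) ` Q" | "B = U" "A \<in> (\<lambda>A. A - U) ` Q"
      | "A \<in> (\<lambda>A. A - U) ` Q" "B \<in> (\<lambda>A. A - U) ` Q" by blast
    then show "A \<inter> B = {}"
    proof cases
      case 3
      then obtain A' B' where "A' \<in> Q" "B' \<in> Q" "A = A' - U" "B = B' - U" by blast
      then show ?thesis using disj[of A' B'] \<open>A \<noteq> B\<close> by blast
    qed blast+
  qed
  ultimately have "partition_on (\<Union>(insert U F)) ?Q"
    unfolding partition_on_def by simp
  moreover have "?Q \<subseteq> R" using Q(1) insert.prems Diff by auto
  ultimately show ?case using Q(2) by (intro exI[of _ ?Q]) auto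
qed

section \<open>Borel sets of a subspace and inner regularity of probabilities\<close>

lemma sets_restrict_borel_openin:
  assumes "openin (top_of_set X) U"
  shows "U \<in> sets (restrict_space borel X)"
proof -
  obtain V where "open V" "U = X \<inter> V" using assms unfolding openin_open by blast
  then show ?thesis by (auto simp: sets_restrict_space)
qed

lemma sets_restrict_borel_closedin:
  assumes "closedin (top_of_set X) U"
  shows "U \<in> sets (restrict_space borel X)"
proof -
  obtain V where "closed V" "U = X \<inter> V" using assms unfolding closedin_closed by blast
  then show ?thesis by (auto simp: sets_restrict_space)
qed

lemma borel_measurable_continuous_on_borel_probs:
  fixes \<phi> :: "'a::metric_space \<Rightarrow> 'b::metric_space"
  assumes "sets \<nu> = sets (restrict_space borel X)" "continuous_on X \<phi>"
  shows "\<phi> \<in> borel_measurable \<nu>"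
  using borel_measurable_continuous_on_restrict[OF assms(2)]
  by (simp add: measurable_cong_sets[OF assms(1) refl])

lemma borel_probsD:
  assumes "\<nu> \<in> borel_probs X"
  shows "prob_space \<nu>" "sets \<nu> = sets (restrict_space borel X)" "space \<nu> = X"
proof -
  show "prob_space \<nu>" and sets: "sets \<nu> = sets (restrict_space borel X)"
    using assms unfolding borel_probs_def by blast+
  show "space \<nu> = X"
    using sets_eq_imp_space_eq[OF sets] by (simp add: space_restrict_space)
qed

text \<open>The trace of a generated sigma-algebra is generated by the traces of its generators.
  This form permits induction over \<open>sigma_sets\<close> starting from relatively open
  sets.\<close>

lemma sets_restrict_borel_eq:
  "sets (restrict_space borel X) = sigma_sets X {U. openin (top_of_set X) U}"
proof -
  have "sets (restrict_space borel X) = {(\<lambda>x. x) -` A \<inter> X | A. A \<in> sigma_sets UNIV {S. open S}}"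
    by (simp add: sets_restrict_space borel_def) blast
  also have "\<dots> = sigma_sets X {(\<lambda>x. x) -` A \<inter> X | A. A \<in> {S. open S}}"
    by (rule sigma_sets_vimage_commute) simp
  also have "{(\<lambda>x. x) -` A \<inter> X | A. A \<in> {S. open S}} = {U. openin (top_of_set X) U}"
    unfolding openin_open by blast
  finally show ?thesis .
qed

text \<open>An open set is the increasing union of the closed sets \<open>F n\<close> of points at
  distance at least \<open>1/(n+1)\<close> from its complement; continuity from above then applies
  to \<open>U - F n\<close>.\<close>

lemma borel_probs_inner_regular_open:
  fixes X :: "'a::metric_space set"
  assumes "\<nu> \<in> borel_probs X" "openin (top_of_set X) U" "0 < e"
  shows "\<exists>F\<subseteq>U. closedin (top_of_set X) F \<and> measure \<nu> (U - F) < e"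
\<comment> \<open>\<open>infdist\<close> to the empty set is 0 by convention, so for
  \<open>U = X\<close> the sets \<open>F n\<close> defined below would all be empty.\<close>
proof (cases "U = X")
  case True
  with assms show ?thesis by (intro exI[of _ X]) auto
next
  case False
  interpret prob_space \<nu> using assms borel_probsD by blast
  have UX: "U \<subseteq> X" using assms(2) openin_imp_subset by blast
  have ne: "X - U \<noteq> {}" using UX False by blast
  define F where "F n = {x \<in> X. inverse (real (Suc n)) \<le> infdist x (X - U)}" for n
  have Fcl: "closedin (top_of_set X) (F n)" for n
  proof -
    have "closedin (top_of_set X) (X \<inter> (\<lambda>x. infdist x (X - U)) -` {inverse (real (Suc n))..})"
      by (intro continuous_closedin_preimage continuous_intros)
    then show ?thesis unfolding F_def by (simp add: vimage_def Int_def)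
  qed
  have FU: "F n \<subseteq> U" for n
  proof
    fix x assume x: "x \<in> F n"
    have "0 < inverse (real (Suc n))" by simp
    then have "infdist x (X - U) \<noteq> 0" using x unfolding F_def by force
    then have "x \<notin> X - U" using infdist_zero by metis
    then show "x \<in> U" using x F_def by auto
  qed
  have "(\<Inter>n. U - F n) = {}"
  proof (rule equals0I)
    fix x assume x: "x \<in> (\<Inter>n. U - F n)"
    then have xU: "x \<in> U" by auto
    have cl: "closedin (top_of_set X) (X - U)"
      using closedin_diff[OF closedin_topspace assms(2)] by simp
    have "infdist x (X - U) \<noteq> 0"
    proof
      assume "infdist x (X - U) = 0"
      then have "x \<in> closure (X - U)" using in_closure_iff_infdist_zero[OF ne] by simp
      moreover obtain C where C: "closed C" "X - U = X \<inter> C" using cl unfolding closedin_closed by blast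
      moreover have "closure (X - U) \<subseteq> C" using C by (intro closure_minimal) auto
      ultimately show False using xU UX by blast
    qed
    then have "0 < infdist x (X - U)" by (simp add: infdist_nonneg order_le_neq_trans)
    then obtain n where "inverse (real (Suc n)) < infdist x (X - U)" using reals_Archimedean by blast
    then have "x \<in> F n" using xU UX by (auto simp: F_def)
    then show False using x by blast
  qed
  moreover have "(\<lambda>n. measure \<nu> (U - F n)) \<longlonglongrightarrow> measure \<nu> (\<Inter>n. U - F n)"
  proof (rule finite_Lim_measure_decseq)
    show "range (\<lambda>n. U - F n) \<subseteq> events"
      using sets_restrict_borel_openin[OF assms(2)] sets_restrict_borel_closedin[OF Fcl]
        borel_probsD(2)[OF assms(1)] by auto
    have "F n \<subseteq> F (Suc n)" for n
    proof -
      have "inverse (real (Suc (Suc n))) \<le> inverse (real (Suc n))"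
        by (rule le_imp_inverse_le) auto
      then show ?thesis unfolding F_def using order_trans by blast
    qed
    then show "decseq (\<lambda>n. U - F n)" by (intro decseq_SucI) auto
  qed
  ultimately have "(\<lambda>n. measure \<nu> (U - F n)) \<longlonglongrightarrow> 0" by (simp only: measure_empty)
  then obtain n where "measure \<nu> (U - F n) < e"
    using eventually_happens'[OF sequentially_bot order_tendstoD(2)[OF _ assms(3)]] by blast
  then show ?thesis using Fcl FU by blast
qed

text \<open>The sets that can be squeezed between a closed and an open set with small gap form a
  sigma-algebra containing the open sets. Approximating from both sides is what makes the property
  stable under complements.\<close>

lemma borel_probs_closed_open_regular:
  fixes X :: "'a::metric_space set"
  assumes \<nu>: "\<nu> \<in> borel_probs X" and A: "A \<in> sets (restrict_space borel X)" and e: "0 < e"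
  shows "\<exists>F U. closedin (top_of_set X) F \<and> openin (top_of_set X) U \<and> F \<subseteq> A \<and> A \<subseteq> U
           \<and> measure \<nu> (U - F) < e"
proof -
  interpret prob_space \<nu> using \<nu> borel_probsD by blast
  have op: "openin (top_of_set X) U \<Longrightarrow> U \<in> events" for U
    using \<nu> borel_probsD(2) sets_restrict_borel_openin by blast
  have cl: "closedin (top_of_set X) U \<Longrightarrow> U \<in> events" for U
    using \<nu> borel_probsD(2) sets_restrict_borel_closedin by blast
  have "A \<in> sigma_sets X {U. openin (top_of_set X) U}"
    using A sets_restrict_borel_eq by blast
  then show ?thesis using e
  proof (induction arbitrary: e)
    case (Basic U)
    then show ?case using borel_probs_inner_regular_open[OF \<nu>, of U e] by blast
  next
    case Empty
    then show ?case by (intro exI[of _ "{}"]) auto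
  next
    case (Compl A)
    then obtain F U where FU: "closedin (top_of_set X) F" "openin (top_of_set X) U" "F \<subseteq> A" "A \<subseteq> U"
      "measure \<nu> (U - F) < e" by meson
    have "(X - F) - (X - U) = U - F" using openin_imp_subset[OF FU(2)] by blast
    with FU show ?case
      by (intro exI[of _ "X - U"] exI[of _ "X - F"]) auto
  next
    case (Union A)
    \<comment> \<open>The gaps \<open>e / 2 * (1/2) ^ Suc i\<close> add up to \<open>e / 2\<close>;
      the other half of \<open>e\<close> is reserved for truncating the union of closed
      sets.\<close>
    have "\<exists>F U. closedin (top_of_set X) F \<and> openin (top_of_set X) U \<and> F \<subseteq> A i \<and> A i \<subseteq> U
           \<and> measure \<nu> (U - F) < e / 2 * (1/2) ^ Suc i" for i :: nat
      by (intro Union.IH) (use Union.prems in simp)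
    then obtain F U where FU: "\<And>i. closedin (top_of_set X) (F i)" "\<And>i. openin (top_of_set X) (U i)"
      "\<And>i. F i \<subseteq> A i" "\<And>i. A i \<subseteq> U i"
      "\<And>i. measure \<nu> (U i - F i) < e / 2 * (1/2) ^ Suc i" by metis
    let ?U = "\<Union>i. U i" let ?G = "\<lambda>n. \<Union>i<n. F i" let ?F = "\<Union>i. F i"
    have Fs: "range F \<subseteq> events" using cl FU(1) by auto
    have Us: "range U \<subseteq> events" using op FU(2) by auto
    have UF: "measure \<nu> (?U - ?F) \<le> e / 2"
    proof -
      have s: "summable (\<lambda>i. e / 2 * (1/2) ^ Suc i :: real)"
        by (intro summable_mult) (auto simp: summable_Suc_iff intro!: summable_geometric)
      have s': "summable (\<lambda>i. measure \<nu> (U i - F i))"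
        by (rule summable_comparison_test'[OF s, of 0]) (use FU(5) less_imp_le in auto)
      have "measure \<nu> (?U - ?F) \<le> measure \<nu> (\<Union>i. U i - F i)"
        using Us Fs by (intro finite_measure_mono) auto
      also have "\<dots> \<le> (\<Sum>i. measure \<nu> (U i - F i))"
        using Us Fs s' by (intro finite_measure_subadditive_countably) auto
      also have "\<dots> \<le> (\<Sum>i. e / 2 * (1/2) ^ Suc i)"
        using FU(5) by (intro suminf_le s s') (auto intro: less_imp_le)
      also have "\<dots> = e / 2"
        using sums_mult[OF power_half_series, of "e/2"] by (simp add: sums_iff)
      finally show ?thesis .
    qed
    \<comment> \<open>The union \<open>?F\<close> of all \<open>F i\<close> need not be closed, so a
      finite union \<open>?G n\<close> replaces it at a cost that tends to 0.\<close>
    have "(\<lambda>n. measure \<nu> (?U - ?G n)) \<longlonglongrightarrow> measure \<nu> (\<Inter>n. ?U - ?G n)"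
    proof (rule finite_Lim_measure_decseq)
      show "range (\<lambda>n. ?U - ?G n) \<subseteq> events" using Us Fs by auto
      show "decseq (\<lambda>n. ?U - ?G n)" by (intro decseq_SucI) (auto simp: less_Suc_eq)
    qed
    moreover have "(\<Inter>n. ?U - ?G n) = ?U - ?F" by auto
    ultimately have "\<forall>\<^sub>F n in sequentially. measure \<nu> (?U - ?G n) < e"
      using UF Union.prems by (intro order_tendstoD(2)[of _ "measure \<nu> (?U - ?F)"]) auto
    then obtain n where n: "measure \<nu> (?U - ?G n) < e"
      using eventually_happens'[OF sequentially_bot] by blast
    have "?G n \<subseteq> (\<Union>i. A i)" using FU(3) by fast
    moreover have "(\<Union>i. A i) \<subseteq> ?U" using FU(4) by fast
    moreover have "closedin (top_of_set X) (?G n)"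
      by (intro closedin_Union) (use FU(1) in auto)
    moreover have "openin (top_of_set X) ?U" using FU(2) by auto
    ultimately show ?case using n by (intro exI[of _ "?G n"] exI[of _ ?U]) simp
  qed
qed

lemma borel_probs_inner_regular:
  fixes X :: "'a::metric_space set"
  assumes "compact X" "\<nu> \<in> borel_probs X" "A \<in> sets (restrict_space borel X)" "0 < e"
  obtains K where "compact K" "K \<subseteq> A" "measure \<nu> (A - K) < e"
proof -
  interpret prob_space \<nu> using assms borel_probsD by blast
  obtain F U where FU: "closedin (top_of_set X) F" "openin (top_of_set X) U" "F \<subseteq> A" "A \<subseteq> U"
      "measure \<nu> (U - F) < e"
    using borel_probs_closed_open_regular[OF assms(2-4)] by blast
  have "U - F \<in> events"
    using sets_restrict_borel_openin[OF FU(2)] sets_restrict_borel_closedin[OF FU(1)]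
      borel_probsD(2)[OF assms(2)] by auto
  then have "measure \<nu> (A - F) \<le> measure \<nu> (U - F)"
    using FU(4) by (intro finite_measure_mono) auto
  then show ?thesis using that[of F] FU closedin_compact[OF assms(1)] by auto
qed

text \<open>Uniform inner regularity is all that admissibility of a constant sequence asks for: finitely
  many disjoint compact sets are automatically separated.\<close>

definition uniformly_inner_regular :: "(nat \<Rightarrow> 'a::metric_space measure) \<Rightarrow> 'a set \<Rightarrow> bool" where
  "uniformly_inner_regular \<mu> A \<longleftrightarrow>
     (\<forall>\<epsilon>>0. \<exists>K. compact K \<and> K \<subseteq> A \<and> (\<forall>n. measure (\<mu> n) (A - K) \<le> \<epsilon>))"

text \<open>The distance attains its minimum on a product of two compact sets, and disjointness
  makes this minimum positive; there are finitely many pairs.\<close>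

lemma finite_disjoint_compacts_separated:
  fixes K :: "'b \<Rightarrow> 'a::metric_space set"
  assumes "finite Q" "\<And>A. A \<in> Q \<Longrightarrow> compact (K A)"
    and "\<And>A B. A \<in> Q \<Longrightarrow> B \<in> Q \<Longrightarrow> A \<noteq> B \<Longrightarrow> K A \<inter> K B = {}"
  shows "\<exists>\<delta>>0. \<forall>A\<in>Q. \<forall>B\<in>Q. A \<noteq> B \<longrightarrow> (\<forall>x\<in>K A. \<forall>y\<in>K B. \<delta> \<le> dist x y)"
proof -
  have "\<exists>d>0. \<forall>x\<in>K A. \<forall>y\<in>K B. d \<le> dist x y" if "A \<in> Q" "B \<in> Q" "A \<noteq> B" for A B
  proof (cases "K A \<times> K B = {}")
    case False
    have "compact (K A \<times> K B)" by (intro compact_Times assms(2) that)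
    moreover have "continuous_on (K A \<times> K B) (\<lambda>p. dist (fst p) (snd p))"
      by (intro continuous_intros)
    ultimately obtain p where p: "p \<in> K A \<times> K B"
      "\<forall>q\<in>K A \<times> K B. dist (fst p) (snd p) \<le> dist (fst q) (snd q)"
      using continuous_attains_inf False by blast
    have "fst p \<noteq> snd p" using p(1) assms(3)[OF that] by auto
    then show ?thesis using p(2) by (intro exI[of _ "dist (fst p) (snd p)"]) auto
  qed (auto intro: exI[of _ 1])
  then have "\<forall>A B. \<exists>d. A \<in> Q \<and> B \<in> Q \<and> A \<noteq> B \<longrightarrow>
      d > 0 \<and> (\<forall>x\<in>K A. \<forall>y\<in>K B. d \<le> dist x y)" by blast
  then obtain d where d: "\<And>A B. A \<in> Q \<Longrightarrow> B \<in> Q \<Longrightarrow> A \<noteq> B \<Longrightarrow>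
      d A B > 0 \<and> (\<forall>x\<in>K A. \<forall>y\<in>K B. d A B \<le> dist x y)" by (simp only: choice_iff) blast
  define P where "P = {p \<in> Q \<times> Q. fst p \<noteq> snd p}"
  \<comment> \<open>The extra element 1 keeps the set under \<open>Min\<close> nonempty when there
    are no two distinct indices.\<close>
  define \<delta> where "\<delta> = Min (insert 1 ((\<lambda>p. d (fst p) (snd p)) ` P))"
  have fin: "finite P" using assms(1) unfolding P_def by auto
  have "\<delta> > 0" unfolding \<delta>_def using fin d by (auto simp: P_def)
  moreover have "\<delta> \<le> d A B" if "A \<in> Q" "B \<in> Q" "A \<noteq> B" for A B
    unfolding \<delta>_def using fin that by (intro Min_le) (auto simp: P_def image_iff)
  ultimately show ?thesis
    using d by (intro exI[of _ \<delta>]) force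
qed

section \<open>Constant sequences of partitions and their scales\<close>

lemma constant_admissible:
  assumes Q: "finite_borel_partition X Q" and reg: "\<And>A. A \<in> Q \<Longrightarrow> uniformly_inner_regular \<mu> A"
  shows "(\<lambda>n. Q) \<in> admissible X \<mu>"
  unfolding admissible_def
proof (intro CollectI conjI allI impI)
  show "\<exists>N. \<forall>n::nat. card Q \<le> N" by blast
  fix \<epsilon> :: real assume "\<epsilon> > 0"
  then have "\<forall>A\<in>Q. \<exists>K. compact K \<and> K \<subseteq> A \<and> (\<forall>n. measure (\<mu> n) (A - K) \<le> \<epsilon>)"
    using reg unfolding uniformly_inner_regular_def by blast
  from bchoice[OF this] obtain K where
    K: "\<And>A. A \<in> Q \<Longrightarrow> compact (K A) \<and> K A \<subseteq> A \<and> (\<forall>n. measure (\<mu> n) (A - K A) \<le> \<epsilon>)"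
    by blast
  have "A \<inter> B = {}" if "A \<in> Q" "B \<in> Q" "A \<noteq> B" for A B
    using Q that by (auto simp: finite_borel_partition_def partition_on_def disjoint_def)
  then have "K A \<inter> K B = {}" if "A \<in> Q" "B \<in> Q" "A \<noteq> B" for A B
    using K that by blast
  then have "\<exists>\<delta>>0. \<forall>A\<in>Q. \<forall>B\<in>Q. A \<noteq> B \<longrightarrow> (\<forall>x\<in>K A. \<forall>y\<in>K B. \<delta> \<le> dist x y)"
    using Q K by (intro finite_disjoint_compacts_separated) (simp_all add: finite_borel_partition_def)
  then obtain \<delta> where "\<delta> > 0" "\<forall>A\<in>Q. \<forall>B\<in>Q. A \<noteq> B \<longrightarrow> (\<forall>x\<in>K A. \<forall>y\<in>K B. \<delta> \<le> dist x y)" by blast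
  with K show "\<exists>\<delta>>0. \<exists>K. \<forall>n::nat. (\<forall>A\<in>Q. compact (K n A) \<and> K n A \<subseteq> A \<and> measure (\<mu> n) (A - K n A) \<le> \<epsilon>) \<and>
            (\<forall>A\<in>Q. \<forall>B\<in>Q. A \<noteq> B \<longrightarrow> (\<forall>x\<in>K n A. \<forall>y\<in>K n B. \<delta> \<le> dist x y))"
    by (intro exI[of _ \<delta>] conjI exI[of _ "\<lambda>n. K"]) auto
qed (use Q in simp)

lemma constant_fine_scale_sequence:
  fixes X :: "'a::metric_space set"
  assumes X: "compact X" "X \<noteq> {}"
    and ex: "\<And>\<alpha>. \<alpha> > 0 \<Longrightarrow> \<exists>Q. finite_borel_partition X Q \<and> (\<forall>A\<in>Q. diameter A \<le> \<alpha>) \<and>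
              (\<forall>A\<in>Q. uniformly_inner_regular \<mu> A)"
  shows "\<exists>P. fine_scale_sequence X \<mu> P \<and> (\<forall>k. \<exists>Q. \<forall>n. P k n = Q)"
proof -
  have "\<exists>Q. finite_borel_partition X Q \<and> (\<forall>A\<in>Q. diameter A \<le> inverse (real (Suc k))) \<and>
              (\<forall>A\<in>Q. uniformly_inner_regular \<mu> A)" for k
    by (rule ex) simp
  then have "\<forall>k. \<exists>Q. finite_borel_partition X Q \<and> (\<forall>A\<in>Q. diameter A \<le> inverse (real (Suc k))) \<and>
              (\<forall>A\<in>Q. uniformly_inner_regular \<mu> A)" by blast
  from choice[OF this] obtain Q where Q: "\<And>k. finite_borel_partition X (Q k)"
    "\<And>k A. A \<in> Q k \<Longrightarrow> diameter A \<le> inverse (real (Suc k))"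
    "\<And>k A. A \<in> Q k \<Longrightarrow> uniformly_inner_regular \<mu> A" by blast
  \<comment> \<open>A supremum of reals is meaningful only over a nonempty bounded family, and a
    diameter is known to be nonnegative only for bounded sets.\<close>
  have ne: "Q k \<noteq> {}" for k
    using Q(1)[of k] X(2) by (auto simp: finite_borel_partition_def partition_on_def)
  have fin: "finite (Q k)" for k
    using Q(1)[of k] by (auto simp: finite_borel_partition_def)
  have bdd: "bounded A" if "A \<in> Q k" for A k
  proof -
    have "A \<subseteq> X" using that Q(1)[of k] by (auto simp: finite_borel_partition_def partition_on_def)
    then show ?thesis using compact_imp_bounded[OF X(1)] bounded_subset by blast
  qed
  have "0 \<le> (SUP A\<in>Q k. diameter A)" for k
  proof -
    obtain A where "A \<in> Q k" using ne by blast
    then show ?thesis using fin bdd diameter_ge_0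
      by (intro cSUP_upper2[of _ _ A]) auto
  qed
  moreover have "(SUP A\<in>Q k. diameter A) \<le> inverse (real (Suc k))" for k
    using ne Q(2) by (intro cSUP_least)
  ultimately have "(\<lambda>k. diam_seq (\<lambda>n. Q k)) \<longlonglongrightarrow> 0"
    unfolding diam_seq_def
    by (intro tendsto_sandwich[OF _ _ tendsto_const LIMSEQ_inverse_real_of_nat]) auto
  then have "fine_scale_sequence X \<mu> (\<lambda>k n. Q k)"
    unfolding fine_scale_sequence_def using constant_admissible Q(1,3) by blast
  then show ?thesis by blast
qed

section \<open>Weak* compactness\<close>

text \<open>Up to the factor \<open>3/2\<close> this is the usual parametrization of the Cantor set.
  With digits 0 and 1 in base 3 the expansions leave gaps, so that close values share their leading
  digits; in base 2 this fails.\<close>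

definition ternary :: "(nat \<Rightarrow> bool) \<Rightarrow> real" where
  "ternary b = (\<Sum>j. of_bool (b j) * (1/3) ^ j)"

lemma summable_ternary: "summable (\<lambda>j. of_bool (b j) * (1/3) ^ j :: real)"
  by (rule summable_comparison_test'[of "\<lambda>j. (1/3) ^ j :: real" 0]) (auto simp: summable_geometric)

lemma ternary_nonneg: "0 \<le> ternary b"
  unfolding ternary_def by (rule suminf_nonneg[OF summable_ternary]) simp

lemma ternary_le: "ternary b \<le> 3 / 2"
proof -
  have "ternary b \<le> (\<Sum>j. (1/3) ^ j)"
    unfolding ternary_def by (rule suminf_le[OF _ summable_ternary]) (auto simp: summable_geometric)
  also have "\<dots> = 3 / 2" by (subst suminf_geometric) auto
  finally show ?thesis .
qed

lemma ternary_Suc: "ternary b = of_bool (b 0) + ternary (\<lambda>j. b (Suc j)) / 3"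
  using suminf_split_head[OF summable_ternary, of b] suminf_divide[OF summable_ternary, of "\<lambda>j. b (Suc j)" 3]
  by (simp add: ternary_def field_simps)

text \<open>The gaps of the middle-thirds set: the leading digits are determined with uniform precision.\<close>

lemma ternary_close_imp_digits_eq:
  assumes "\<bar>ternary b - ternary c\<bar> < (1/3) ^ J / 2" "j < J"
  shows "b j = c j"
  using assms
proof (induction J arbitrary: b c j)
  case (Suc J)
  let ?b = "\<lambda>j. b (Suc j)" and ?c = "\<lambda>j. c (Suc j)"
  have "(1/3) ^ Suc J \<le> (1::real)" by (rule power_le_one) auto
  then have small: "\<bar>ternary b - ternary c\<bar> < 1 / 2" using Suc.prems(1) by linarith
  \<comment> \<open>Distinct first digits contribute 1 to the difference, and the tails can
    compensate at most \<open>(3/2) / 3 = 1/2\<close> of it.\<close>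
  have eq0: "b 0 = c 0"
  proof (rule ccontr)
    assume "b 0 \<noteq> c 0"
    then show False
      using small ternary_nonneg[of ?b] ternary_nonneg[of ?c] ternary_le[of ?b] ternary_le[of ?c]
      unfolding ternary_Suc[of b] ternary_Suc[of c] by (cases "b 0"; cases "c 0") auto
  qed
  \<comment> \<open>Dropping a common first digit multiplies the difference by 3, which turns the
    bound for \<open>Suc J\<close> into the one for \<open>J\<close>.\<close>
  have "\<bar>ternary ?b - ternary ?c\<bar> < (1/3) ^ J / 2"
  proof -
    have "ternary b - ternary c = (ternary ?b - ternary ?c) / 3"
      using eq0 unfolding ternary_Suc[of b] ternary_Suc[of c] by (simp add: field_simps)
    then have "\<bar>ternary b - ternary c\<bar> = \<bar>ternary ?b - ternary ?c\<bar> / 3" by (simp only: abs_divide)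
    then show ?thesis using Suc.prems(1) by simp
  qed
  from Suc.IH[OF this] have "b (Suc i) = c (Suc i)" if "i < J" for i using that .
  then show ?case using Suc.prems(2) eq0 by (cases j) simp_all
qed simp

text \<open>The sets \<open>B j\<close> enumerate the balls of radius \<open>1/(m+1)\<close> around
  a finite net, for all \<open>m\<close>. Points that agree on all balls of one scale lie in a
  common ball of that scale.\<close>

lemma compact_countable_separating_family:
  fixes X :: "'a::metric_space set"
  assumes "compact X"
  shows "\<exists>B :: nat \<Rightarrow> 'a set. (\<forall>j. open (B j)) \<and>
    (\<forall>e>0. \<exists>J. \<forall>x\<in>X. \<forall>y\<in>X. (\<forall>j<J. x \<in> B j \<longleftrightarrow> y \<in> B j) \<longrightarrow> dist x y < e)"
proof (cases "X = {}")
  case False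
  have "\<exists>F. finite F \<and> F \<subseteq> X \<and> X \<subseteq> (\<Union>c\<in>F. ball c (inverse (Suc m)))" for m :: nat
    by (rule compactE_image[OF assms, of X "\<lambda>c. ball c (inverse (Suc m))"]) auto
  then obtain F where F: "\<And>m. finite (F m)" "\<And>m. X \<subseteq> (\<Union>c\<in>F m. ball c (inverse (Suc m)))"
    by metis
  define P where "P = Sigma UNIV F"
  define B where "B j = (case from_nat_into P j of (m, c) \<Rightarrow> ball c (inverse (Suc m)))" for j
  have "countable P" unfolding P_def using F(1) by (intro countable_SIGMA) (auto intro: countable_finite)
  have "F 0 \<noteq> {}" using F(2)[of 0] False by auto
  then have "P \<noteq> {}" unfolding P_def by auto
  then have ran: "range (from_nat_into P) = P"
    using \<open>countable P\<close> by (rule range_from_nat_into)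
  have "\<exists>J. \<forall>x\<in>X. \<forall>y\<in>X. (\<forall>j<J. x \<in> B j \<longleftrightarrow> y \<in> B j) \<longrightarrow> dist x y < e" if e: "e > 0" for e
  proof -
    obtain m where m: "inverse (real (Suc m)) < e / 2" using reals_Archimedean[of "e/2"] e by auto
    \<comment> \<open>The finitely many balls of scale \<open>m\<close> all occur at indices below
      some \<open>J\<close>.\<close>
    have "finite ({m} \<times> F m)" "{m} \<times> F m \<subseteq> range (from_nat_into P)"
      using F(1) ran by (auto simp: P_def)
    then obtain I where I: "finite I" "{m} \<times> F m = from_nat_into P ` I"
      using finite_subset_image[of "{m} \<times> F m" "from_nat_into P" UNIV] by auto
    obtain J where J: "I \<subseteq> {..<J}" using finite_nat_iff_bounded[THEN iffD1, OF I(1)] by blast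
    have "dist x y < e" if xy: "x \<in> X" "y \<in> X" "\<forall>j<J. x \<in> B j \<longleftrightarrow> y \<in> B j" for x y
    proof -
      obtain c where c: "c \<in> F m" "x \<in> ball c (inverse (Suc m))" using F(2)[of m] xy(1) by blast
      then have "(m, c) \<in> from_nat_into P ` I" using I(2) by blast
      then obtain j where j: "j < J" "from_nat_into P j = (m, c)" using J by auto
      then have "y \<in> ball c (inverse (Suc m))" using xy(3) c(2) unfolding B_def by auto
      then show ?thesis using c(2) m dist_triangle_half_r[of c x e y] by auto
    qed
    then show ?thesis by blast
  qed
  moreover have "open (B j)" for j unfolding B_def by (auto split: prod.split)
  ultimately show ?thesis by blast
qed (auto intro: exI[of _ "\<lambda>_. {}"])

lemma compact_metric_real_coding:
  fixes X :: "'a::metric_space set"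
  assumes X: "compact X"
  obtains h :: "'a \<Rightarrow> real" and c :: "real \<Rightarrow> 'a" and C
  where "h \<in> borel_measurable (restrict_space borel X)" "closed C" "h ` X \<subseteq> C" "C \<subseteq> {0..3/2}"
    "continuous_on C c" "c ` C \<subseteq> X" "\<And>x. x \<in> X \<Longrightarrow> c (h x) = x"
proof -
  obtain B :: "nat \<Rightarrow> 'a set" where B: "\<And>j. open (B j)"
    "\<And>e. e > 0 \<Longrightarrow> \<exists>J. \<forall>x\<in>X. \<forall>y\<in>X. (\<forall>j<J. x \<in> B j \<longleftrightarrow> y \<in> B j) \<longrightarrow> dist x y < e"
    using compact_countable_separating_family[OF X] by blast
  define h where "h x = ternary (\<lambda>j. x \<in> B j)" for x
  define C where "C = closure (h ` X)"
  have uc: "\<exists>d>0. \<forall>x\<in>X. \<forall>y\<in>X. \<bar>h x - h y\<bar> < d \<longrightarrow> dist x y < e" if "e > 0" for e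
  proof -
    obtain J where J: "\<forall>x\<in>X. \<forall>y\<in>X. (\<forall>j<J. x \<in> B j \<longleftrightarrow> y \<in> B j) \<longrightarrow> dist x y < e"
      using B(2)[OF \<open>e > 0\<close>] by blast
    have "dist x y < e" if "x \<in> X" "y \<in> X" "\<bar>h x - h y\<bar> < (1/3) ^ J / 2" for x y
      using J that ternary_close_imp_digits_eq[of "\<lambda>j. x \<in> B j" "\<lambda>j. y \<in> B j" J]
      unfolding h_def by blast
    then show ?thesis by (intro exI[of _ "(1/3) ^ J / 2"]) auto
  qed
  \<comment> \<open>\<open>G\<close> is the closure of the graph of the inverse of \<open>h\<close>.
    The extension \<open>c\<close> selects from it; \<open>close\<close> below shows that there is
    only one choice over each \<open>t\<close> and that it varies uniformly continuously.\<close>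
  define G where "G t z \<longleftrightarrow> z \<in> X \<and> (\<exists>x. (\<forall>n. x n \<in> X) \<and> x \<longlonglongrightarrow> z \<and> (\<lambda>n. h (x n)) \<longlonglongrightarrow> t)" for t z
  define c where "c t = (SOME z. G t z)" for t
  have G: "G t (c t)" if t: "t \<in> C" for t
  proof -
    obtain y where y: "\<And>n. y n \<in> h ` X" "y \<longlonglongrightarrow> t"
      using t unfolding C_def closure_sequential by blast
    then have "\<forall>n. \<exists>x\<in>X. y n = h x" by blast
    then obtain x where x: "\<And>n. x n \<in> X" "\<And>n. y n = h (x n)" by metis
    \<comment> \<open>Compactness supplies a point of \<open>X\<close> over every limit
      \<open>t\<close> of codes.\<close>
    obtain z r where zr: "z \<in> X" "strict_mono (r :: nat \<Rightarrow> nat)" "(x \<circ> r) \<longlonglongrightarrow> z"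
      using X x(1) unfolding compact_eq_seq_compact_metric seq_compact_def by metis
    have "(\<lambda>n. h ((x \<circ> r) n)) \<longlonglongrightarrow> t"
      using LIMSEQ_subseq_LIMSEQ[OF y(2) zr(2)] x(2) by (simp add: o_def)
    then have "G t z" unfolding G_def using zr x(1) by (intro conjI exI[of _ "x \<circ> r"]) auto
    then show ?thesis unfolding c_def by (rule someI)
  qed
  have close: "\<exists>d>0. \<forall>s t y z. \<bar>s - t\<bar> < d \<longrightarrow> G s y \<longrightarrow> G t z \<longrightarrow> dist y z \<le> e" if "e > 0" for e
  proof -
    obtain d where d: "d > 0" "\<And>x y. x \<in> X \<Longrightarrow> y \<in> X \<Longrightarrow> \<bar>h x - h y\<bar> < d \<Longrightarrow> dist x y < e"
      using uc[OF \<open>e > 0\<close>] by blast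
    have "dist y z \<le> e" if st: "\<bar>s - t\<bar> < d" and Gs: "G s y" "G t z" for s t y z
    proof -
      obtain u where u: "\<And>n. u n \<in> X" "u \<longlonglongrightarrow> y" "(\<lambda>n. h (u n)) \<longlonglongrightarrow> s" using Gs(1) G_def by blast
      obtain v where v: "\<And>n. v n \<in> X" "v \<longlonglongrightarrow> z" "(\<lambda>n. h (v n)) \<longlonglongrightarrow> t" using Gs(2) G_def by blast
      have "(\<lambda>n. \<bar>h (u n) - h (v n)\<bar>) \<longlonglongrightarrow> \<bar>s - t\<bar>" by (intro tendsto_intros u v)
      then have "\<forall>\<^sub>F n in sequentially. \<bar>h (u n) - h (v n)\<bar> < d" using st by (rule order_tendstoD)
      then have "\<forall>\<^sub>F n in sequentially. dist (u n) (v n) \<le> e"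
        by eventually_elim (use d(2) u(1) v(1) less_imp_le in blast)
      \<comment> \<open>Passing to the limit weakens the strict bound of \<open>uc\<close> to a
        non-strict one, which is why continuity of \<open>c\<close> is later derived from
        \<open>e / 2\<close>.\<close>
      then show ?thesis by (rule tendsto_upperbound[OF tendsto_dist[OF u(2) v(2)]]) simp
    qed
    with d(1) show ?thesis by blast
  qed
  have "h \<in> borel_measurable (restrict_space borel X)"
  proof -
    have "(\<lambda>x. \<Sum>j. of_bool (x \<in> B j) * (1/3) ^ j :: real) = (\<lambda>x. \<Sum>j. indicator (B j) x * (1/3) ^ j)"
      by (simp add: indicator_def of_bool_def)
    moreover have "\<dots> \<in> borel_measurable borel"
      using B(1) by (intro borel_measurable_suminf borel_measurable_times borel_measurable_indicator) auto
    ultimately show ?thesis unfolding h_def ternary_def by (intro measurable_restrict_space1) simp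
  qed
  moreover have "closed C" "h ` X \<subseteq> C" unfolding C_def by (rule closed_closure, rule closure_subset)
  moreover have "C \<subseteq> {0..3/2}"
    unfolding C_def by (rule closure_minimal)
      (simp_all only: h_def image_subset_iff atLeastAtMost_iff ternary_nonneg ternary_le closed_atLeastAtMost simp_thms ball_triv)
  moreover have "continuous_on C c"
    unfolding continuous_on_iff
  proof (intro ballI allI impI)
    fix t and e :: real assume t: "t \<in> C" and e: "e > 0"
    obtain d where "d > 0" "\<forall>s t y z. \<bar>s - t\<bar> < d \<longrightarrow> G s y \<longrightarrow> G t z \<longrightarrow> dist y z \<le> e / 2"
      using close[of "e/2"] e by auto
    then show "\<exists>d>0. \<forall>s\<in>C. dist s t < d \<longrightarrow> dist (c s) (c t) < e"
      using G t e by (intro exI[of _ d]) (fastforce simp: dist_real_def)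
  qed
  moreover have "c ` C \<subseteq> X" using G G_def by blast
  moreover have "c (h x) = x" if x: "x \<in> X" for x
  proof -
    have "G (h x) x" unfolding G_def using x by (intro conjI exI[of _ "\<lambda>_. x"]) auto
    moreover have "G (h x) (c (h x))" using G x \<open>h ` X \<subseteq> C\<close> by blast
    \<comment> \<open>Both \<open>x\<close> and \<open>c (h x)\<close> lie over the same code
      \<open>h x\<close>, so \<open>close\<close> bounds their distance by every positive
      \<open>e\<close>.\<close>
    ultimately have *: "dist (c (h x)) x \<le> e" if "e > 0" for e
    proof -
      obtain d where "d > 0" "\<forall>s t y z. \<bar>s - t\<bar> < d \<longrightarrow> G s y \<longrightarrow> G t z \<longrightarrow> dist y z \<le> e"
        using close[OF \<open>e > 0\<close>] by blast
      moreover from this(1) have "\<bar>h x - h x\<bar> < d" by simp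
      ultimately show ?thesis using \<open>G (h x) x\<close> \<open>G (h x) (c (h x))\<close> by blast
    qed
    have "dist (c (h x)) x \<le> 0" by (rule field_le_epsilon) (use * in simp)
    then show ?thesis by simp
  qed
  ultimately show ?thesis by (rule that)
qed

section \<open>Subsequential limits in the weak* sense\<close>

lemma integrable_continuous_borel_probs:
  fixes \<phi> :: "'a::metric_space \<Rightarrow> real"
  assumes X: "compact X" and \<nu>: "\<nu> \<in> borel_probs X" and \<phi>: "continuous_on X \<phi>"
  shows "integrable \<nu> \<phi>"
proof -
  interpret prob_space \<nu> using \<nu> borel_probsD by blast
  obtain b where "\<And>x. x \<in> X \<Longrightarrow> norm (\<phi> x) \<le> b"
    using compact_imp_bounded[OF compact_continuous_image[OF \<phi> X]] unfolding bounded_iff by blast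
  then show ?thesis
    using borel_measurable_continuous_on_borel_probs[OF borel_probsD(2)[OF \<nu>] \<phi>] borel_probsD(3)[OF \<nu>]
    by (intro integrable_const_bound[of _ b]) auto
qed

text \<open>The measures are moved to the real line by \<open>h\<close>, and a weak limit there is
  moved back by \<open>c\<close>. Although \<open>h\<close> is not continuous,
  \<open>\<phi> \<circ> c\<close> is continuous on \<open>C\<close> for continuous
  \<open>\<phi>\<close>, so convergence on the line controls the integrals of
  \<open>\<phi>\<close>.\<close>

lemma borel_probs_sequentially_compact:
  fixes X :: "'a::metric_space set" and \<mu> :: "nat \<Rightarrow> 'a measure"
  assumes X: "compact X" and \<mu>: "\<And>n. \<mu> n \<in> borel_probs X"
  obtains r \<nu> where "strict_mono (r :: nat \<Rightarrow> nat)" "\<nu> \<in> borel_probs X"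
    "\<And>\<phi> :: 'a \<Rightarrow> real. continuous_on X \<phi> \<Longrightarrow> (\<lambda>n. LINT x|\<mu> (r n). \<phi> x) \<longlonglongrightarrow> (LINT x|\<nu>. \<phi> x)"
proof -
  obtain h :: "'a \<Rightarrow> real" and c C where hc:
    "h \<in> borel_measurable (restrict_space borel X)" "closed C" "h ` X \<subseteq> C" "C \<subseteq> {0..3/2}"
    "continuous_on C c" "c ` C \<subseteq> X" "\<And>x. x \<in> X \<Longrightarrow> c (h x) = x"
    by (rule compact_metric_real_coding[OF X]) (rule that)
  note D = borel_probsD[OF \<mu>]
  have h[measurable]: "h \<in> borel_measurable (\<mu> n)" for n
    using hc(1) by (simp add: measurable_cong_sets[OF D(2) refl])
  define \<mu>' where "\<mu>' n = distr (\<mu> n) borel h" for n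
  have \<mu>'_real: "real_distribution (\<mu>' n)" for n
    unfolding \<mu>'_def using prob_space.real_distribution_distr[OF D(1) h] .
  have tight: "tight \<mu>'"
    unfolding tight_def
  proof (intro conjI allI impI \<mu>'_real)
    fix \<epsilon> :: real assume "\<epsilon> > 0"
    \<comment> \<open>All codes lie in \<open>[0, 3/2]\<close>, so a single interval carries the
      full mass of every image measure.\<close>
    have "measure (\<mu>' n) {-1<..2} = 1" for n
    proof -
      have "h -` {-1<..2} \<inter> space (\<mu> n) = space (\<mu> n)"
        using hc(3,4) D(3)[of n] by fastforce
      then show ?thesis
        unfolding \<mu>'_def using prob_space.prob_space[OF D(1)] by (subst measure_distr) auto
    qed
    then show "\<exists>a b. a < b \<and> (\<forall>n. 1 - \<epsilon> < measure (\<mu>' n) {a<..b})"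
      using \<open>\<epsilon> > 0\<close> by (intro exI[of _ "-1"] exI[of _ 2]) auto
  qed
  then obtain r M where r: "strict_mono (r :: nat \<Rightarrow> nat)" and M: "real_distribution M"
    and conv: "weak_conv_m (\<mu>' \<circ> id \<circ> r) M"
    using tight_imp_convergent_subsubsequence[OF tight, of id] by (auto simp: strict_mono_id)
  interpret M: real_distribution M by (rule M)
  have conv_int: "(\<lambda>n. LINT t|\<mu>' (r n). g t) \<longlonglongrightarrow> (LINT t|M. g t)"
    if g: "continuous_on UNIV g" "\<And>t. norm (g t) \<le> b" for g :: "real \<Rightarrow> real" and b
  proof -
    have "isCont g t" for t using g(1) by (simp add: continuous_on_eq_continuous_at)
    then show ?thesis
      using weak_conv_imp_integral_bdd_continuous_conv[OF _ M conv, of g b] \<mu>'_real g(2) by (simp add: o_def)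
  qed
  have int_\<mu>': "(LINT t|\<mu>' n. g t) = (LINT x|\<mu> n. g (h x))"
    if "g \<in> borel_measurable borel" for g :: "real \<Rightarrow> real" and n
    unfolding \<mu>'_def using that by (subst integral_distr) auto
  have Cne: "C \<noteq> {}"
    using prob_space.not_empty[OF D(1)] D(3) hc(3) by fastforce
  have AE_C: "AE t in M. t \<in> C"
  proof -
    \<comment> \<open>The distance to \<open>C\<close>, truncated at 1, is a bounded continuous test
      function that vanishes on all codes; its integral against the limit is therefore 0.\<close>
    let ?g = "\<lambda>t. min 1 (infdist t C)"
    have g: "continuous_on UNIV ?g" by (intro continuous_intros)
    have "(LINT t|\<mu>' n. ?g t) = 0" for n
    proof -
      have "(LINT t|\<mu>' n. ?g t) = (LINT x|\<mu> n. ?g (h x))"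
        using g by (intro int_\<mu>' borel_measurable_continuous_onI)
      also have "\<dots> = (LINT x|\<mu> n. 0)"
        using hc(3) D(3)[of n] by (intro Bochner_Integration.integral_cong) (auto simp: image_subset_iff)
      finally show ?thesis by simp
    qed
    moreover have "norm (?g t) \<le> 1" for t by (simp add: infdist_nonneg)
    ultimately have "(LINT t|M. ?g t) = 0"
      using conv_int[OF g, of 1] by (simp add: LIMSEQ_const_iff)
    moreover have "integrable M ?g"
      using borel_measurable_continuous_onI[OF g]
      by (intro M.integrable_const_bound[of _ 1])
        (simp_all add: infdist_nonneg measurable_cong_sets[OF M.events_eq_borel refl])
    ultimately have "AE t in M. ?g t = 0"
      by (subst (asm) integral_nonneg_eq_0_iff_AE) (auto simp: infdist_nonneg)
    then show ?thesis
    proof eventually_elim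
      case (elim t)
      then show ?case using in_closed_iff_infdist_zero[OF hc(2) Cne, of t] by (auto simp: min_def split: if_splits)
    qed
  qed
  obtain x0 where x0: "x0 \<in> X" using Cne hc(6) by blast
  \<comment> \<open>The value \<open>x0\<close> off \<open>C\<close> is arbitrary: it makes
    \<open>c'\<close> a total Borel map into \<open>X\<close> and is taken only on an
    \<open>M\<close>-null set.\<close>
  define c' where "c' t = (if t \<in> C then c t else x0)" for t
  have c'X: "c' t \<in> X" for t using hc(6) x0 by (auto simp: c'_def)
  have c'[measurable]: "c' \<in> measurable M (restrict_space borel X)"
  proof (rule measurable_restrict_space2)
    have "c' \<in> borel_measurable borel"
      unfolding c'_def using hc(2,5) by (intro borel_measurable_continuous_on_if) auto
    then show "c' \<in> borel_measurable M" by simp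
  qed (use c'X in auto)
  define \<nu> where "\<nu> = distr M (restrict_space borel X) c'"
  have \<nu>: "\<nu> \<in> borel_probs X"
    unfolding borel_probs_def \<nu>_def using M.prob_space_distr[OF c'] by simp
  moreover have "(\<lambda>n. LINT x|\<mu> (r n). \<phi> x) \<longlonglongrightarrow> (LINT x|\<nu>. \<phi> x)" if \<phi>: "continuous_on X \<phi>" for \<phi> :: "'a \<Rightarrow> real"
  proof -
    obtain b0 where b0: "\<And>x. x \<in> X \<Longrightarrow> norm (\<phi> x) \<le> b0"
      using compact_imp_bounded[OF compact_continuous_image[OF \<phi> X]] unfolding bounded_iff by blast
    have "continuous_on C (\<lambda>t. \<phi> (c t))"
      by (rule continuous_on_compose2[OF \<phi> hc(5,6)])
    moreover have "closedin (top_of_set UNIV) C" using hc(2) by simp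
    moreover have "norm (\<phi> (c t)) \<le> max 0 b0" if "t \<in> C" for t
      using b0[of "c t"] hc(6) that by fastforce
    \<comment> \<open>Tietze extends \<open>\<phi> \<circ> c\<close> to a bounded continuous
      function on the line, a legitimate test function for weak convergence.\<close>
    ultimately obtain g where g: "continuous_on UNIV g" "\<And>t. t \<in> C \<Longrightarrow> g t = \<phi> (c t)"
      "\<And>t. norm (g t) \<le> max 0 b0"
      using Tietze[of C "\<lambda>t. \<phi> (c t)" UNIV "max 0 b0"] by auto
    have gm: "g \<in> borel_measurable borel" using g(1) by (rule borel_measurable_continuous_onI)
    have "(LINT t|\<mu>' n. g t) = (LINT x|\<mu> n. \<phi> x)" for n
      unfolding int_\<mu>'[OF gm] using D(3)[of n] hc(3,7) g(2)
      by (intro Bochner_Integration.integral_cong) (auto simp: image_subset_iff)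
    moreover have "(LINT t|M. g t) = (LINT x|\<nu>. \<phi> x)"
    proof -
      have \<phi>m: "\<phi> \<in> borel_measurable (restrict_space borel X)"
        using \<phi> by (rule borel_measurable_continuous_on_restrict)
      have "(LINT x|\<nu>. \<phi> x) = (LINT t|M. \<phi> (c' t))"
        unfolding \<nu>_def by (rule integral_distr[OF c' \<phi>m])
      also have "\<dots> = (LINT t|M. g t)"
        using AE_C g(2) gm measurable_compose[OF c' \<phi>m]
        by (intro integral_cong_AE) (auto simp: c'_def elim!: eventually_mono)
      finally show ?thesis ..
    qed
    ultimately show ?thesis using conv_int[OF g(1,3)] by simp
  qed
  ultimately show ?thesis using that r by blast
qed

text \<open>For a subbasic open set, eventual membership of the subsequence is convergence of one
  integral; induction over the generation of the topology gives it for all open neighbourhoods of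
  \<open>\<nu>\<close>.\<close>

lemma weak_limitsI:
  fixes X :: "'a::metric_space set"
  assumes \<mu>: "\<And>n. \<mu> n \<in> borel_probs X" and r: "strict_mono (r :: nat \<Rightarrow> nat)" and \<nu>: "\<nu> \<in> borel_probs X"
    and conv: "\<And>\<phi> :: 'a \<Rightarrow> real. continuous_on X \<phi> \<Longrightarrow> (\<lambda>n. LINT x|\<mu> (r n). \<phi> x) \<longlonglongrightarrow> (LINT x|\<nu>. \<phi> x)"
  shows "\<nu> \<in> weak_limits X \<mu>"
proof -
  let ?F = "{\<lambda>\<mu>. LINT x|\<mu>. \<phi> x | \<phi> :: 'a \<Rightarrow> real. continuous_on X \<phi>}"
  let ?S = "{{m \<in> borel_probs X. \<psi> m \<in> U} | \<psi> U. \<psi> \<in> ?F \<and> open U}"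
  have ev: "\<forall>\<^sub>F n in sequentially. \<mu> (r n) \<in> U" if "generate_topology_on ?S U" "\<nu> \<in> U" for U
    using that
  proof (induction rule: generate_topology_on.induct)
    case (Int a b)
    then show ?case by (auto intro: eventually_conj)
  next
    case (UN K)
    then obtain k where "k \<in> K" "\<nu> \<in> k" by blast
    then show ?case using UN.IH[of k] by (auto elim: eventually_mono)
  next
    case (Basis s)
    then obtain \<phi> :: "'a \<Rightarrow> real" and U where s: "continuous_on X \<phi>" "open U"
      "s = {m \<in> borel_probs X. (LINT x|m. \<phi> x) \<in> U}" by auto
    have "\<forall>\<^sub>F n in sequentially. (LINT x|\<mu> (r n). \<phi> x) \<in> U"
      using topological_tendstoD[OF conv[OF s(1)] s(2)] Basis.prems s(3) by auto
    then show ?case using s(3) \<mu> by (auto elim: eventually_mono)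
  qed simp
  have "\<exists>\<^sub>F n in sequentially. \<mu> n \<in> U" if "openin (weak_star_topology X) U" "\<nu> \<in> U" for U
  proof -
    have "generate_topology_on ?S U"
      using that(1) unfolding weak_star_topology_def initial_topology_def openin_topology_generated_by_iff .
    from ev[OF this that(2)] obtain N where N: "\<And>n. n \<ge> N \<Longrightarrow> \<mu> (r n) \<in> U"
      unfolding eventually_sequentially by blast
    have "\<exists>n\<ge>m. \<mu> n \<in> U" for m
      using N[of "max N m"] seq_suble[OF r, of "max N m"] by (intro exI[of _ "r (max N m)"]) auto
    then show ?thesis unfolding frequently_sequentially by blast
  qed
  moreover have "\<nu> \<in> topspace (weak_star_topology X)"
  proof -
    \<comment> \<open>One test function suffices to exhibit all of \<open>borel_probs X\<close> as a
      subbasic set, which puts \<open>\<nu>\<close> into the carrier of the topology.\<close>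
    have "(\<lambda>\<mu>. LINT x|\<mu>. (0::real)) \<in> ?F" by (intro CollectI exI[of _ "\<lambda>_. 0"]) auto
    then have "{m \<in> borel_probs X. (LINT x|m. (0::real)) \<in> UNIV} \<in> ?S" by blast
    then show ?thesis
      using \<nu> unfolding weak_star_topology_def initial_topology_def topology_generated_by_topspace by blast
  qed
  ultimately show ?thesis unfolding weak_limits_def limit_points_seq_def by blast
qed

section \<open>Neighbourhoods with small frontiers\<close>

text \<open>\<open>N\<close> is an abstract notion of negligible frontier. Since the frontier of a
  difference lies in the union of the two frontiers, the small sets with negligible frontier are
  closed under differences, and a finite cover by them can be made disjoint.\<close>

lemma partition_from_small_neighbourhoods:
  fixes X :: "'a::metric_space set"
  assumes X: "compact X" and \<alpha>: "\<alpha> > 0"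
    and N_mono: "\<And>S T. N T \<Longrightarrow> S \<subseteq> T \<Longrightarrow> N S"
    and N_Un: "\<And>S T. N S \<Longrightarrow> N T \<Longrightarrow> N (S \<union> T)"
    and nbhd: "\<And>x W. openin (top_of_set X) W \<Longrightarrow> x \<in> W \<Longrightarrow>
        \<exists>U. openin (top_of_set X) U \<and> x \<in> U \<and> U \<subseteq> W \<and> N (top_of_set X frontier_of U)"
  shows "\<exists>Q. finite_borel_partition X Q \<and> (\<forall>A\<in>Q. diameter A < \<alpha>) \<and>
           (\<forall>A\<in>Q. N (top_of_set X frontier_of A))"
proof -
  let ?T = "top_of_set X"
  \<comment> \<open>A bound on pairwise distances passes to differences at once; the value
    \<open>\<alpha> / 2\<close> leaves room for the strict bound on diameters and is met inside
    balls of radius \<open>\<alpha> / 4\<close>.\<close>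
  define R where "R = {A. A \<in> sets (restrict_space borel X) \<and>
    (\<forall>x\<in>A. \<forall>y\<in>A. dist x y \<le> \<alpha> / 2) \<and> N (?T frontier_of A)}"
  have Diff: "A - B \<in> R" if "A \<in> R" "B \<in> R" for A B
  proof -
    have "A \<subseteq> X" using that(1) by (auto simp: R_def sets_restrict_space)
    then have "A - B = A \<inter> (topspace ?T - B)" by auto
    then have "?T frontier_of (A - B) \<subseteq> ?T frontier_of A \<union> ?T frontier_of B"
      using frontier_of_Int_subset[of ?T A "topspace ?T - B"] by (simp only: frontier_of_complement)
    moreover have "N (?T frontier_of A \<union> ?T frontier_of B)"
      using that unfolding R_def by (intro N_Un) auto
    ultimately have "N (?T frontier_of (A - B))" using N_mono by blast
    then show ?thesis using that unfolding R_def by auto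
  qed
  have "\<exists>U\<in>R. openin ?T U \<and> x \<in> U" if "x \<in> X" for x
  proof -
    have "openin ?T (X \<inter> ball x (\<alpha>/4))" by (simp add: openin_open_Int)
    moreover have "x \<in> X \<inter> ball x (\<alpha>/4)" using that \<alpha> by auto
    ultimately obtain U where U: "openin ?T U" "x \<in> U" "U \<subseteq> X \<inter> ball x (\<alpha>/4)"
      "N (?T frontier_of U)" using nbhd by blast
    have "dist y z \<le> \<alpha> / 2" if "y \<in> U" "z \<in> U" for y z
    proof -
      have "dist x y < \<alpha> / 4" "dist x z < \<alpha> / 4" using U(3) that by (auto simp: subset_iff)
      then show ?thesis using dist_triangle2[of y z x] by (simp add: dist_commute)
    qed
    then have "U \<in> R" unfolding R_def using U sets_restrict_borel_openin by auto
    then show ?thesis using U by blast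
  qed
  then have "X \<subseteq> \<Union>{U \<in> R. openin ?T U}" by blast
  moreover have "compactin ?T X" using X by (simp add: compactin_subtopology)
  ultimately obtain F where F: "finite F" "F \<subseteq> {U \<in> R. openin ?T U}" "X \<subseteq> \<Union>F"
    using compactinD[of ?T X "{U \<in> R. openin ?T U}"] by auto
  have "\<Union>F \<subseteq> X" using F(2) openin_imp_subset by blast
  then have "\<Union>F = X" using F(3) by blast
  moreover have "F \<subseteq> R" using F(2) by blast
  ultimately obtain Q where Q: "Q \<subseteq> R" "finite Q" "partition_on X Q"
    using partition_of_Union_in_ring[OF F(1) _ Diff] by auto
  have "diameter A < \<alpha>" if "A \<in> Q" for A
  proof -
    have "diameter A \<le> \<alpha> / 2" using that Q(1) \<alpha> by (intro diameter_leI) (auto simp: R_def)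
    then show ?thesis using \<alpha> by simp
  qed
  then show ?thesis
    using Q by (intro exI[of _ Q]) (auto simp: finite_borel_partition_def R_def)
qed

text \<open>On the interval and the circle every dense \<open>D\<close> has this property.\<close>

definition small_frontiers :: "'a topology \<Rightarrow> 'a set \<Rightarrow> bool" where
  "small_frontiers T D \<longleftrightarrow> (\<forall>W x. openin T W \<longrightarrow> x \<in> W \<longrightarrow>
     (\<exists>U. openin T U \<and> x \<in> U \<and> U \<subseteq> W \<and> finite (T frontier_of U) \<and> T frontier_of U \<subseteq> D))"

lemma small_frontiers_homeomorphic:
  assumes hom: "homeomorphic_map S T h" and sf: "small_frontiers T (h ` D)" and D: "D \<subseteq> topspace S"
  shows "small_frontiers S D"
  unfolding small_frontiers_def
proof (intro allI impI)
  fix W x assume W: "openin S W" "x \<in> W"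
  have inj: "inj_on h (topspace S)" using hom homeomorphic_imp_injective_map by blast
  have WS: "W \<subseteq> topspace S" using W(1) openin_subset by blast
  have "openin T (h ` W)" using homeomorphic_map_openness[OF hom WS] W(1) by simp
  moreover have "h x \<in> h ` W" using W(2) by simp
  ultimately obtain V where V: "openin T V" "h x \<in> V" "V \<subseteq> h ` W" "finite (T frontier_of V)"
    "T frontier_of V \<subseteq> h ` D" using sf[unfolded small_frontiers_def, rule_format, of "h ` W" "h x"] by auto
  define U where "U = {y \<in> W. h y \<in> V}"
  have hU: "h ` U = V" using V(3) unfolding U_def by auto
  have US: "U \<subseteq> topspace S" using WS U_def by auto
  have "openin S U" using homeomorphic_map_openness[OF hom US] hU V(1) by simp
  moreover have fr: "h ` (S frontier_of U) = T frontier_of V"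
    using homeomorphic_map_frontier_of[OF hom US] hU by simp
  have frS: "S frontier_of U \<subseteq> topspace S" by (rule frontier_of_subset_topspace)
  have "finite (S frontier_of U)"
    using V(4) finite_imageD[OF _ inj_on_subset[OF inj frS]] fr by simp
  moreover have "S frontier_of U \<subseteq> D"
    using V(5) inj_on_image_subset_iff[OF inj frS D] fr by simp
  ultimately show "\<exists>U. openin S U \<and> x \<in> U \<and> U \<subseteq> W \<and> finite (S frontier_of U) \<and> S frontier_of U \<subseteq> D"
    using W(2) V(2) U_def by blast
qed

text \<open>The closure of \<open>U\<close> stays inside the closed set \<open>U \<union> F\<close>,
  and an open set is disjoint from its frontier.\<close>

lemma frontier_of_subsetI:
  assumes "openin T U" "closedin T (U \<union> F)"
  shows "T frontier_of U \<subseteq> F"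
  using assms closure_of_minimal[of U "U \<union> F" T] by (auto simp: frontier_of_openin)

lemma small_frontiers_unit_interval:
  assumes D: "D \<subseteq> {0..1::real}" "{0..1} \<subseteq> closure D"
  shows "small_frontiers (top_of_set {0..1}) D"
  unfolding small_frontiers_def
proof (intro allI impI)
  fix W and x :: real assume W: "openin (top_of_set {0..1}) W" "x \<in> W"
  have x: "x \<in> {0..1}" using W openin_imp_subset by blast
  obtain e where e: "e > 0" "\<And>y. y \<in> {0..1} \<Longrightarrow> dist y x < e \<Longrightarrow> y \<in> W"
    using W unfolding openin_euclidean_subtopology_iff by blast
  have D_dense: "\<exists>d\<in>D. u < d \<and> d < v" if "u < v" "0 \<le> u" "v \<le> 1" for u v
  proof -
    have "(u + v) / 2 \<in> closure D \<inter> {u<..<v}" using that D(2) by auto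
    then have "D \<inter> {u<..<v} \<noteq> {}"
      by (metis Int_commute empty_iff open_Int_closure_eq_empty open_greaterThanLessThan)
    then show ?thesis by auto
  qed
  \<comment> \<open>At \<open>x = 0\<close> no point of \<open>D\<close> lies to the left. A
    negative \<open>a\<close> serves instead: being outside the space, it contributes nothing to the
    frontier.\<close>
  have "\<exists>a. a < x \<and> x - e < a \<and> (a \<in> D \<or> a < 0)"
  proof (cases "x = 0")
    case True
    then show ?thesis using e(1) by (intro exI[of _ "-e/2"]) auto
  next
    case False
    then show ?thesis using D_dense[of "max 0 (x - e)" x] x e(1) by auto
  qed
  then obtain a where a: "a < x" "x - e < a" "a \<in> D \<or> a < 0" by blast
  have "\<exists>b. x < b \<and> b < x + e \<and> (b \<in> D \<or> 1 < b)"
  proof (cases "x = 1")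
    case True
    then show ?thesis using e(1) by (intro exI[of _ "1+e/2"]) auto
  next
    case False
    then show ?thesis using D_dense[of x "min 1 (x + e)"] x e(1) by auto
  qed
  then obtain b where b: "x < b" "b < x + e" "b \<in> D \<or> 1 < b" by blast
  let ?U = "{0..1} \<inter> {a<..<b}"
  have op: "openin (top_of_set {0..1}) ?U" by (simp add: openin_open_Int)
  have "?U \<union> ({a,b} \<inter> {0..1}) = {0..1} \<inter> {a..b}" using a(1) b(1) by auto
  then have "closedin (top_of_set {0..1}) (?U \<union> ({a,b} \<inter> {0..1}))"
    using closedin_closed_Int[of "{a..b}" "{0..1}"] by (simp only: closed_atLeastAtMost)
  then have fr: "top_of_set {0..1} frontier_of ?U \<subseteq> {a,b} \<inter> {0..1}"
    using op by (rule frontier_of_subsetI[rotated])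
  have "{a,b} \<inter> {0..1} \<subseteq> D" using a b by auto
  moreover have "?U \<subseteq> W" using e(2) a b by (auto simp: dist_real_def)
  ultimately show "\<exists>U. openin (top_of_set {0..1}) U \<and> x \<in> U \<and> U \<subseteq> W \<and>
       finite (top_of_set {0..1} frontier_of U) \<and> top_of_set {0..1} frontier_of U \<subseteq> D"
    using op a b x fr by (intro exI[of _ ?U]) (auto intro: finite_subset)
qed

section \<open>Open arcs of the circle\<close>

lemma cis_image_Icc_2pi: "cis ` {a..a + 2 * pi} = sphere 0 1"
proof
  show "sphere 0 1 \<subseteq> cis ` {a..a + 2 * pi}"
  proof
    fix z :: complex assume "z \<in> sphere 0 1"
    then have z: "z = cis (Arg z)" using cis_Arg_unique rcis_cmod_Arg[of z] by (simp add: rcis_def)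
    \<comment> \<open>The number of full turns that moves \<open>Arg z\<close> into the prescribed
      interval.\<close>
    define k where "k = \<lceil>(a - Arg z) / (2 * pi)\<rceil>"
    have "(a - Arg z) / (2 * pi) \<le> k" "k < (a - Arg z) / (2 * pi) + 1"
      unfolding k_def by linarith+
    then have "Arg z + 2 * pi * k \<in> {a..a + 2 * pi}"
      by (auto simp: field_simps)
    moreover have "cis (Arg z + 2 * pi * k) = z"
      using z by (simp flip: cis_mult)
    ultimately show "z \<in> cis ` {a..a + 2 * pi}" by (metis imageI)
  qed
qed auto

lemma cis_eq_imp_eq:
  assumes "cis s = cis t" "\<bar>s - t\<bar> < 2 * pi"
  shows "s = t"
proof -
  have "sin s = sin t" "cos s = cos t" using assms(1) by (auto simp: cis.ctr)
  then obtain n :: int where n: "s = t + 2 * pi * n" using sin_cos_eq_iff by metis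
  then have "\<bar>real_of_int n\<bar> < 1" using assms(2) by (simp add: abs_mult)
  then have "n = 0" by linarith
  then show ?thesis using n by simp
qed

text \<open>The complement of the open arc is the image of the compact interval
  \<open>{b..a + 2 * pi}\<close>, hence closed.\<close>

lemma openin_cis_image:
  assumes "a < b" "b \<le> a + 2 * pi"
  shows "openin (top_of_set (sphere 0 1)) (cis ` {a<..<b})"
proof -
  have "cis ` {a<..<b} \<union> cis ` {b..a + 2 * pi} = sphere 0 1"
  proof -
    \<comment> \<open>The parameter \<open>a\<close> lies in neither interval; its point on the
      circle is reached through the other end \<open>a + 2 * pi\<close>.\<close>
    have "cis a = cis (a + 2 * pi)" by (simp flip: cis_mult)
    then have "cis ` {a..a+2*pi} \<subseteq> cis ` ({a<..<b} \<union> {b..a+2*pi})"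
    proof (intro image_subsetI)
      fix t assume t: "t \<in> {a..a+2*pi}"
      have "cis t \<in> cis ` {b..a+2*pi}" if "t = a"
        using that \<open>cis a = cis (a + 2 * pi)\<close> assms(2) by (intro image_eqI[of _ _ "a + 2 * pi"]) auto
      moreover have "t \<in> {a<..<b} \<union> {b..a+2*pi}" if "t \<noteq> a" using t that by auto
      ultimately show "cis t \<in> cis ` ({a<..<b} \<union> {b..a+2*pi})" by blast
    qed
    then show ?thesis using cis_image_Icc_2pi[of a] by (auto simp: image_Un)
  qed
  moreover have "cis ` {a<..<b} \<inter> cis ` {b..a + 2 * pi} = {}"
  proof -
    have "cis s \<noteq> cis t" if "a < s" "s < b" "b \<le> t" "t \<le> a + 2 * pi" for s t
      using cis_eq_imp_eq[of s t] that by auto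
    then show ?thesis by fastforce
  qed
  ultimately have "cis ` {a<..<b} = sphere 0 1 - cis ` {b..a + 2 * pi}" by blast
  moreover have "compact (cis ` {b..a + 2 * pi})"
    by (intro compact_continuous_image continuous_intros) auto
  ultimately show ?thesis
    by (metis Diff_Compl Diff_eq compact_imp_closed open_Compl openin_open_Int)
qed

lemma small_frontiers_circle:
  assumes D: "D \<subseteq> sphere (0::complex) 1" "sphere 0 1 \<subseteq> closure D"
  shows "small_frontiers (top_of_set (sphere 0 1)) D"
  unfolding small_frontiers_def
proof (intro allI impI)
  let ?T = "top_of_set (sphere (0::complex) 1)"
  fix W and x :: complex assume W: "openin ?T W" "x \<in> W"
  have x: "x \<in> sphere 0 1" using W openin_imp_subset by blast
  then obtain \<theta> where \<theta>: "x = cis \<theta>" using cis_image_Icc_2pi by blast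
  obtain O' where O': "open O'" "W = sphere 0 1 \<inter> O'" using W(1) by (auto simp: openin_open)
  have "open (cis -` O')" using O'(1) by (intro open_vimage continuous_intros) auto
  moreover have "\<theta> \<in> cis -` O'" using W(2) O'(2) \<theta> by auto
  ultimately obtain e0 where e0: "e0 > 0" "\<And>t. dist t \<theta> < e0 \<Longrightarrow> cis t \<in> O'"
    unfolding open_dist by auto
  \<comment> \<open>Capping at 1, which is below \<open>pi\<close>, keeps the arc between
    \<open>\<theta> - e\<close> and \<open>\<theta> + e\<close> shorter than a full turn.\<close>
  define e where "e = min e0 1"
  have e: "e > 0" "e < pi" "\<And>t. dist t \<theta> < e \<Longrightarrow> cis t \<in> W"
    using e0 O'(2) pi_gt3 by (auto simp: e_def)
  have D_dense: "\<exists>t. u < t \<and> t < v \<and> cis t \<in> D" if uv: "u < v" "v \<le> u + 2 * pi" for u v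
  proof -
    obtain V where V: "open V" "cis ` {u<..<v} = sphere 0 1 \<inter> V"
      using openin_cis_image[OF uv] by (auto simp: openin_open)
    have "cis ((u + v) / 2) \<in> V" using V(2) uv by auto
    moreover have "cis ((u + v) / 2) \<in> closure D" using D(2) by (auto simp: subset_iff)
    ultimately have "V \<inter> D \<noteq> {}" using V(1) open_Int_closure_eq_empty by blast
    then obtain d where d: "d \<in> V" "d \<in> D" by blast
    then have "d \<in> cis ` {u<..<v}" using V(2) D(1) by blast
    then show ?thesis using d(2) by auto
  qed
  obtain a where a: "\<theta> - e < a" "a < \<theta>" "cis a \<in> D" using D_dense[of "\<theta> - e" \<theta>] e by auto
  obtain b where b: "\<theta> < b" "b < \<theta> + e" "cis b \<in> D" using D_dense[of \<theta> "\<theta> + e"] e by auto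
  let ?U = "cis ` {a<..<b}"
  have op: "openin ?T ?U" using a b e by (intro openin_cis_image) auto
  have "{a..b} = {a<..<b} \<union> {a,b}" using a b by auto
  then have "?U \<union> {cis a, cis b} = cis ` {a..b}" by auto
  moreover have "compact (cis ` {a..b})"
    by (intro compact_continuous_image continuous_intros) auto
  moreover have "cis ` {a..b} \<subseteq> sphere 0 1" by auto
  ultimately have "closedin ?T (?U \<union> {cis a, cis b})"
    by (simp add: closed_subset compact_imp_closed)
  then have fr: "?T frontier_of ?U \<subseteq> {cis a, cis b}" using op frontier_of_subsetI by blast
  have "?U \<subseteq> W" using e(3) a b by (auto simp: dist_real_def)
  then show "\<exists>U. openin ?T U \<and> x \<in> U \<and> U \<subseteq> W \<and> finite (?T frontier_of U) \<and> ?T frontier_of U \<subseteq> D"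
    using op a b fr \<theta> by (intro exI[of _ ?U]) (auto intro: finite_subset)
qed

section \<open>Comparison of the circle metrics and transfer to isometric spaces\<close>

lemma norm_cis_diff_le: "norm (cis s - cis t) \<le> \<bar>s - t\<bar>"
proof -
  have "norm (cis s - cis t) = norm (cis (s - t) - 1)"
  proof -
    \<comment> \<open>Rotation reduces the claim to a chord from 1, whose length is given by the
      half-angle formula.\<close>
    have "cis s - cis t = cis t * (cis (s - t) - 1)"
      by (simp add: algebra_simps cis_mult)
    then show ?thesis by (simp add: norm_mult)
  qed
  also have "\<dots> = 2 * \<bar>sin ((s - t) / 2)\<bar>"
    using dist_exp_i_1[of "s - t"] by (simp add: cis_conv_exp)
  also have "\<dots> \<le> \<bar>s - t\<bar>" using abs_sin_x_le_abs_x[of "(s - t)/2"] by simp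
  finally show ?thesis .
qed

lemma dist_le_Arg:
  assumes "z \<in> sphere 0 1" "w \<in> sphere (0::complex) 1"
  shows "dist z w \<le> \<bar>Arg (z / w)\<bar>"
proof -
  have n: "norm (z / w) = 1" using assms by (simp add: norm_divide)
  then have "z / w = cis (Arg (z / w))" using rcis_cmod_Arg[of "z / w"] by (simp add: rcis_def)
  moreover have "z = (z / w) * w" using assms by auto
  ultimately have "z - w = (cis (Arg (z / w)) - cis 0) * w" by (simp add: algebra_simps)
  then have "dist z w = norm (cis (Arg (z / w)) - cis 0)"
    using assms(2) by (simp add: dist_norm norm_mult)
  then show ?thesis using norm_cis_diff_le[of "Arg (z / w)" 0] by simp
qed

text \<open>The bound by \<open>e\<close> makes the isometry Lipschitz for the standard metric of
  \<open>Y\<close>; continuity of its inverse follows because \<open>X\<close> is compact and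
  \<open>Y\<close> is Hausdorff.\<close>

lemma isometric_imp_homeomorphic_map:
  fixes X :: "'a::metric_space set" and Y :: "'b::metric_space set"
  assumes "compact X" "isometric X dist Y e"
    and le: "\<And>y z. y \<in> Y \<Longrightarrow> z \<in> Y \<Longrightarrow> dist y z \<le> C * e y z"
  obtains g where "homeomorphic_map (top_of_set X) (top_of_set Y) g"
proof -
  obtain g where g: "bij_betw g X Y" "\<And>x y. x \<in> X \<Longrightarrow> y \<in> X \<Longrightarrow> e (g x) (g y) = dist x y"
    using assms(2) unfolding isometric_def by blast
  have "dist (g x) (g y) \<le> \<bar>C\<bar> * dist x y" if "x \<in> X" "y \<in> X" for x y
  proof -
    have "dist (g x) (g y) \<le> C * dist x y"
      using le[of "g x" "g y"] g that bij_betwE by fastforce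
    also have "\<dots> \<le> \<bar>C\<bar> * dist x y" by (simp add: mult_right_mono)
    finally show ?thesis .
  qed
  then have "\<bar>C\<bar>-lipschitz_on X g" by (rule lipschitz_onI) simp_all
  then have cont: "continuous_on X g" by (rule lipschitz_on_continuous_on)
  have gX: "g ` X = Y" "inj_on g X" using g(1) unfolding bij_betw_def by auto
  have "homeomorphic_map (top_of_set X) (top_of_set Y) g"
  proof (rule continuous_imp_homeomorphic_map)
    show "compact_space (top_of_set X)" using assms(1) by (simp add: compact_space_subtopology)
    show "Hausdorff_space (top_of_set Y)" by (simp add: Hausdorff_space_subtopology)
    show "continuous_map (top_of_set X) (top_of_set Y) g" using cont gX(1) by auto
  qed (use gX in simp_all)
  then show ?thesis using that by blast
qed

lemma small_frontiers_homeomorphic_top_of_set: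
  fixes X :: "'a::metric_space set" and Y :: "'b::metric_space set"
  assumes hom: "homeomorphic_map (top_of_set X) (top_of_set Y) g"
    and D: "D \<subseteq> X" "X \<subseteq> closure D"
    and Y: "\<And>D'. D' \<subseteq> Y \<Longrightarrow> Y \<subseteq> closure D' \<Longrightarrow> small_frontiers (top_of_set Y) D'"
  shows "small_frontiers (top_of_set X) D"
proof (rule small_frontiers_homeomorphic[OF hom])
  have gX: "g ` X = Y" using homeomorphic_imp_surjective_map[OF hom] by simp
  have gD: "g ` D \<subseteq> Y" using D(1) gX by blast
  have "Y = g ` (X \<inter> closure D)" using gX D(2) by (simp add: Int_absorb2)
  also have "\<dots> = Y \<inter> closure (g ` D)"
    using homeomorphic_map_closure_of[OF hom, of D] D(1) gD
    by (simp add: closure_of_subtopology Int_absorb1)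
  finally have "Y \<subseteq> closure (g ` D)" by blast
  moreover have "g ` D \<subseteq> Y" by (rule gD)
  ultimately show "small_frontiers (top_of_set Y) (g ` D)" by (rule Y[rotated])
qed (use D in simp)

lemma small_frontiers_interval_or_circle:
  fixes X :: "'a::metric_space set"
  assumes "compact X" "unit_interval_space X \<or> circle_space X" "D \<subseteq> X" "X \<subseteq> closure D"
  shows "small_frontiers (top_of_set X) D"
  using assms(2)
proof
  assume "unit_interval_space X"
  then obtain g where "homeomorphic_map (top_of_set X) (top_of_set {0..1::real}) g"
    using isometric_imp_homeomorphic_map[OF assms(1), of "{0..1::real}" dist 1]
    unfolding unit_interval_space_def by auto
  then show ?thesis
    using small_frontiers_homeomorphic_top_of_set assms small_frontiers_unit_interval by blast
next
  assume "circle_space X"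
  then obtain e where e: "e \<in> circle_metrics" "isometric X dist (sphere (0::complex) 1) e"
    unfolding circle_space_def by blast
  \<comment> \<open>The factor \<open>2 * pi\<close> is forced by the normalized arc length; the
    chordal metric and arc length satisfy the bound with factor 1.\<close>
  have "dist y z \<le> 2 * pi * e y z \<or> dist y z \<le> 1 * e y z"
    if "y \<in> sphere 0 1" "z \<in> sphere 0 1" for y z
    using e(1) dist_le_Arg[OF that] unfolding circle_metrics_def by auto
  moreover have "dist y z \<le> 2 * pi * e y z" if "dist y z \<le> 1 * e y z" for y z
  proof -
    have "e y z \<ge> 0" using that zero_le_dist[of y z] by linarith
    then have "1 * e y z \<le> 2 * pi * e y z" using pi_gt3 by (intro mult_right_mono) auto
    then show ?thesis using that by linarith
  qed
  ultimately obtain g where "homeomorphic_map (top_of_set X) (top_of_set (sphere (0::complex) 1)) g"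
    using isometric_imp_homeomorphic_map[OF assms(1) e(2), of "2 * pi"] by blast
  then show ?thesis
    using small_frontiers_homeomorphic_top_of_set assms small_frontiers_circle by blast
qed

lemma small_frontiers_zero_dimensional:
  assumes "zero_dimensional T"
  shows "small_frontiers T D"
  unfolding small_frontiers_def
proof (intro allI impI)
  fix W x assume W: "openin T W" "x \<in> W"
  obtain \<B> where B: "\<And>U. U \<in> \<B> \<Longrightarrow> openin T U \<and> closedin T U"
    "openin T = arbitrary union_of (\<lambda>U. U \<in> \<B>)"
    using assms unfolding zero_dimensional_def by blast
  have "(arbitrary union_of (\<lambda>U. U \<in> \<B>)) W" using W(1) B(2) by simp
  then obtain U where "U \<in> \<B>" "x \<in> U" "U \<subseteq> W"
    using W(2) by (auto simp: union_of_def arbitrary_def)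
  moreover have "T frontier_of U = {}" using B(1)[OF \<open>U \<in> \<B>\<close>] clopenin_eq_frontier_of[of T U] by simp
  ultimately show "\<exists>U. openin T U \<and> x \<in> U \<and> U \<subseteq> W \<and> finite (T frontier_of U) \<and> T frontier_of U \<subseteq> D"
    using B(1) by (intro exI[of _ U]) auto
qed

section \<open>Uniform inner regularity\<close>

text \<open>Each of the first \<open>N\<close> measures is inner regular by itself. Adding their
  finitely many compact sets to \<open>K\<close> keeps it compact and only shrinks
  \<open>A - K\<close>.\<close>

lemma uniformly_inner_regular_finite_initial:
  fixes X :: "'a::metric_space set"
  assumes X: "compact X" and \<mu>: "\<And>n. \<mu> n \<in> borel_probs X" and A: "A \<in> sets (restrict_space borel X)"
    and ev: "\<And>e. e > 0 \<Longrightarrow> \<exists>K N. compact K \<and> K \<subseteq> A \<and> (\<forall>n\<ge>N. measure (\<mu> n) (A - K) \<le> e)"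
  shows "uniformly_inner_regular \<mu> A"
  unfolding uniformly_inner_regular_def
proof (intro allI impI)
  fix e :: real assume e: "e > 0"
  obtain K N where K: "compact K" "K \<subseteq> A" "\<And>n. n \<ge> N \<Longrightarrow> measure (\<mu> n) (A - K) \<le> e"
    using ev[OF e] by blast
  have "\<exists>L. compact L \<and> L \<subseteq> A \<and> measure (\<mu> n) (A - L) \<le> e" for n
    by (rule borel_probs_inner_regular[OF X \<mu> A e, of n]) (auto intro: less_imp_le)
  then obtain L where L: "\<And>n. compact (L n)" "\<And>n. L n \<subseteq> A" "\<And>n. measure (\<mu> n) (A - L n) \<le> e"
    by metis
  have cl: "C \<in> sets (\<mu> n)" if "compact C" "C \<subseteq> A" for C n
  proof -
    have "C \<subseteq> X" using that(2) A by (auto simp: sets_restrict_space)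
    then show ?thesis
      using sets_restrict_borel_closedin[of X C] closedin_compact_eq[OF X, of C] that(1)
        borel_probsD(2)[OF \<mu>] by simp
  qed
  have As: "A \<in> sets (\<mu> n)" for n using A borel_probsD(2)[OF \<mu>] by simp
  have mono: "measure (\<mu> n) (A - C') \<le> measure (\<mu> n) (A - C)"
    if "C \<subseteq> C'" "compact C" "C \<subseteq> A" for C C' n
  proof -
    interpret prob_space "\<mu> n" by (rule borel_probsD(1)[OF \<mu>])
    show ?thesis using that cl As by (intro finite_measure_mono) auto
  qed
  let ?K = "K \<union> (\<Union>n<N. L n)"
  have "measure (\<mu> n) (A - ?K) \<le> e" for n
  proof (cases "n < N")
    case True
    then have "measure (\<mu> n) (A - ?K) \<le> measure (\<mu> n) (A - L n)"
      by (intro mono L(1,2)) auto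
    then show ?thesis using L(3)[of n] by linarith
  next
    case False
    have "measure (\<mu> n) (A - ?K) \<le> measure (\<mu> n) (A - K)"
      by (intro mono K(1,2)) auto
    then show ?thesis using K(3)[of n] False by linarith
  qed
  moreover have "compact ?K" by (intro compact_Un compact_UN K(1) L(1)) auto
  moreover have "?K \<subseteq> A" using K(2) L(2) by blast
  ultimately show "\<exists>K. compact K \<and> K \<subseteq> A \<and> (\<forall>n. measure (\<mu> n) (A - K) \<le> e)" by blast
qed

text \<open>As the zero set of a continuous function, the frontier can be approximated by continuous
  test functions.\<close>

lemma frontier_of_eq_infdist_zero:
  fixes X :: "'a::metric_space set"
  assumes "A \<subseteq> X" "A \<noteq> {}" "X - A \<noteq> {}"
  shows "top_of_set X frontier_of A = {x \<in> X. max (infdist x A) (infdist x (X - A)) = 0}"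
proof -
  have "top_of_set X frontier_of A = X \<inter> closure A \<inter> closure (X - A)"
    using assms(1) by (auto simp: frontier_of_closures closure_of_subtopology Int_absorb1 Int_absorb2)
  moreover have "max (infdist x A) (infdist x (X - A)) = 0 \<longleftrightarrow> x \<in> closure A \<and> x \<in> closure (X - A)" for x
    using infdist_nonneg[of x A] infdist_nonneg[of x "X - A"]
    unfolding in_closure_iff_infdist_zero[OF assms(2)] in_closure_iff_infdist_zero[OF assms(3)]
    by (auto simp: max_def)
  ultimately show ?thesis by auto
qed

lemma null_frontier_imp_uniformly_inner_regular:
  fixes X :: "'a::metric_space set"
  assumes X: "compact X" and \<mu>: "\<And>n. \<mu> n \<in> borel_probs X" and A: "A \<in> sets (restrict_space borel X)"
    and null: "\<And>\<nu>. \<nu> \<in> weak_limits X \<mu> \<Longrightarrow> measure \<nu> (top_of_set X frontier_of A) = 0"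
  shows "uniformly_inner_regular \<mu> A"
proof (cases "A = {} \<or> A = X")
  case True
  then show ?thesis
    unfolding uniformly_inner_regular_def using X by (intro allI impI exI[of _ A]) auto
next
  case False
  have AX: "A \<subseteq> X" using A by (auto simp: sets_restrict_space)
  have ne: "A \<noteq> {}" "X - A \<noteq> {}" using False AX by auto
  define g where "g x = max (infdist x A) (infdist x (X - A))" for x
  have g_cont: "continuous_on X g" unfolding g_def by (intro continuous_intros)
  have g_nonneg: "0 \<le> g x" for x unfolding g_def by (simp add: infdist_nonneg le_max_iff_disj)
  define K where "K m = {x \<in> X. inverse (real (Suc m)) \<le> infdist x (X - A)}" for m
  have K_closed: "closedin (top_of_set X) (K m)" for m
  proof -
    have "closedin (top_of_set X) (X \<inter> (\<lambda>x. infdist x (X - A)) -` {inverse (real (Suc m))..})"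
      by (intro continuous_closedin_preimage continuous_intros)
    then show ?thesis unfolding K_def by (simp add: vimage_def Int_def)
  qed
  have K_compact: "compact (K m)" for m using K_closed closedin_compact[OF X] by blast
  have K_sub: "K m \<subseteq> A" for m
  proof
    fix x assume x: "x \<in> K m"
    have "0 < inverse (real (Suc m))" by simp
    then have "infdist x (X - A) \<noteq> 0" using x unfolding K_def by force
    then have "x \<notin> X - A" using infdist_zero by metis
    then show "x \<in> A" using x K_def by auto
  qed
  \<comment> \<open>On \<open>A\<close> the first distance in \<open>g\<close> vanishes, so
    \<open>g\<close> is the distance to \<open>X - A\<close>, which is small off
    \<open>K m\<close>.\<close>
  have g_small: "g x < inverse (real (Suc m))" if "x \<in> A - K m" for x m
    using that AX infdist_nonneg[of x "X - A"] unfolding g_def K_def by auto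
  show ?thesis
  proof (rule uniformly_inner_regular_finite_initial[OF X \<mu> A], rule ccontr)
    fix e :: real assume e: "e > 0"
    assume "\<nexists>K N. compact K \<and> K \<subseteq> A \<and> (\<forall>n\<ge>N. measure (\<mu> n) (A - K) \<le> e)"
    then have bad: "\<exists>n\<ge>N. e < measure (\<mu> n) (A - K m)" for m N
      using K_compact[of m] K_sub[of m] by (meson not_le)
    \<comment> \<open>Bad indices exist beyond every bound, so they can be chosen strictly
      increasing while the compact sets \<open>K j\<close> grow along with them.\<close>
    have "\<exists>s. \<forall>j. e < measure (\<mu> (s j)) (A - K j) \<and> s j < s (Suc j)"
    proof (rule dependent_nat_choice)
      show "\<exists>n. e < measure (\<mu> n) (A - K 0)" using bad by blast
      show "\<exists>n'. e < measure (\<mu> n') (A - K (Suc j)) \<and> n < n'" for n j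
        using bad[of "Suc n" "Suc j"] by (auto simp: Suc_le_eq)
    qed
    then obtain s where s: "\<And>j. e < measure (\<mu> (s j)) (A - K j)" "strict_mono s"
      by (auto simp: strict_mono_Suc_iff)
    obtain r \<nu> where r: "strict_mono (r :: nat \<Rightarrow> nat)" and \<nu>: "\<nu> \<in> borel_probs X"
      and conv: "\<And>\<phi> :: 'a \<Rightarrow> real. continuous_on X \<phi> \<Longrightarrow> (\<lambda>n. LINT x|\<mu> (s (r n)). \<phi> x) \<longlonglongrightarrow> (LINT x|\<nu>. \<phi> x)"
      using borel_probs_sequentially_compact[OF X, of "\<lambda>n. \<mu> (s n)", OF \<mu>] by blast
    have "strict_mono (\<lambda>n. s (r n))" using strict_mono_o[OF s(2) r] by (simp add: o_def)
    then have "\<nu> \<in> weak_limits X \<mu>"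
      using weak_limitsI[OF \<mu>, where r = "\<lambda>n. s (r n)"] \<nu> conv by simp
    then have null\<nu>: "measure \<nu> {x \<in> X. g x = 0} = 0"
      using null frontier_of_eq_infdist_zero[OF AX ne] unfolding g_def by simp
    \<comment> \<open>The tent functions equal 1 on the frontier and vanish where
      \<open>k * g \<ge> 1\<close>, so they tend pointwise to its indicator.\<close>
    define \<phi> where "\<phi> k x = max 0 (1 - real k * g x)" for k x
    have \<phi>_cont: "continuous_on X (\<phi> k)" for k
      unfolding \<phi>_def by (intro continuous_intros g_cont)
    have \<phi>_bounds: "0 \<le> \<phi> k x" "\<phi> k x \<le> 1" for k x
      unfolding \<phi>_def using g_nonneg[of x] by auto
    have "e / 2 \<le> (LINT x|\<nu>. \<phi> k x)" for k
    proof (rule tendsto_lowerbound[OF conv[OF \<phi>_cont]])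
      show "\<forall>\<^sub>F n in sequentially. e / 2 \<le> (LINT x|\<mu> (s (r n)). \<phi> k x)"
        unfolding eventually_sequentially
      proof (intro exI allI impI)
        \<comment> \<open>From here on \<open>k * g \<le> 1/2\<close> on \<open>?B\<close>, since
          \<open>g\<close> is below \<open>1/(r n + 1)\<close> there and \<open>n \<le> r n\<close>.
          Thus \<open>\<phi> k\<close> is at least \<open>1/2\<close> on a set of mass above
          \<open>e\<close>.\<close>
        fix n assume n: "2 * k \<le> n"
        let ?M = "\<mu> (s (r n))" and ?B = "A - K (r n)"
        interpret prob_space ?M by (rule borel_probsD(1)[OF \<mu>])
        have B: "?B \<in> events"
          using A sets_restrict_borel_closedin[OF K_closed] borel_probsD(2)[OF \<mu>] by auto
        have half: "1 / 2 \<le> \<phi> k x" if "x \<in> ?B" for x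
        proof -
          have "n \<le> r n" using seq_suble[OF r] .
          then have "2 * real k \<le> real (Suc (r n))" using n by linarith
          then have "2 * real k * g x \<le> real (Suc (r n)) * g x"
            using g_nonneg[of x] by (rule mult_right_mono)
          also have "\<dots> \<le> 1" using g_small[OF that] by (simp add: field_simps)
          finally show ?thesis unfolding \<phi>_def by simp
        qed
        have "e / 2 \<le> measure ?M ?B / 2" using s(1)[of "r n"] by simp
        also have "\<dots> = (LINT x|?M. indicator ?B x * (1 / 2))"
          using B by simp
        also have "\<dots> \<le> (LINT x|?M. \<phi> k x)"
        proof (rule integral_mono)
          show "integrable ?M (\<lambda>x. indicator ?B x * (1 / 2) :: real)"
            using B by (intro integrable_mult_left) (simp add: emeasure_eq_measure)
          show "integrable ?M (\<phi> k)"
            by (rule integrable_continuous_borel_probs[OF X \<mu> \<phi>_cont])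
          show "indicator ?B x * (1 / 2) \<le> \<phi> k x" for x
            using half[of x] \<phi>_bounds(1)[of k x] by (cases "x \<in> ?B") simp_all
        qed
        finally show "e / 2 \<le> (LINT x|?M. \<phi> k x)" .
      qed
    qed simp
    \<comment> \<open>Dominated convergence carries the lower bound \<open>e / 2\<close> over to the
      mass of the frontier under \<open>\<nu>\<close>, which is 0.\<close>
    moreover have "(\<lambda>k. LINT x|\<nu>. \<phi> k x) \<longlonglongrightarrow> (LINT x|\<nu>. indicator {x \<in> X. g x = 0} x)"
    proof (rule integral_dominated_convergence[where w = "\<lambda>_. 1"])
      interpret \<nu>: prob_space \<nu> by (rule borel_probsD(1)[OF \<nu>])
      have "closedin (top_of_set X) (X \<inter> g -` {0})"
        by (intro continuous_closedin_preimage g_cont) auto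
      then have "{x \<in> X. g x = 0} \<in> sets \<nu>"
        using sets_restrict_borel_closedin borel_probsD(2)[OF \<nu>] by (auto simp: vimage_def Int_def)
      then show "indicator {x \<in> X. g x = 0} \<in> borel_measurable \<nu>" by simp
      show "\<phi> k \<in> borel_measurable \<nu>" for k
        using integrable_continuous_borel_probs[OF X \<nu> \<phi>_cont] by blast
      show "integrable \<nu> (\<lambda>_. 1 :: real)" by simp
      show "AE x in \<nu>. norm (\<phi> k x) \<le> 1" for k using \<phi>_bounds by auto
      have "(\<lambda>k. \<phi> k x) \<longlonglongrightarrow> indicator {x \<in> X. g x = 0} x" if "x \<in> X" for x
      proof (cases "g x = 0")
        case True
        then show ?thesis using that by (simp add: \<phi>_def)
      next
        case False
        then have gx: "g x > 0" using g_nonneg[of x] by simp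
        obtain N where N: "1 / g x < real N" using reals_Archimedean2 by blast
        have "\<phi> k x = 0" if "k \<ge> N" for k
        proof -
          have "1 / g x \<le> real k" using N that by linarith
          then show ?thesis using gx by (simp add: \<phi>_def field_simps)
        qed
        then show ?thesis
          using False by (intro tendsto_eventually) (auto simp: eventually_sequentially)
      qed
      then show "AE x in \<nu>. (\<lambda>k. \<phi> k x) \<longlonglongrightarrow> indicator {x \<in> X. g x = 0} x"
        using borel_probsD(3)[OF \<nu>] by auto
    qed
    moreover have "(LINT x|\<nu>. indicator {x \<in> X. g x = 0} x) = (0 :: real)"
      using null\<nu> borel_probsD(3)[OF \<nu>] by (simp add: Int_absorb2 subset_iff)
    ultimately have "e / 2 \<le> 0" by (intro LIMSEQ_le_const) auto
    then show False using e by simp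
  qed
qed

section \<open>Relative compactness for setwise convergence\<close>

lemma topspace_initial_topology_subset: "topspace (initial_topology S F) \<subseteq> S"
  unfolding initial_topology_def topology_generated_by_topspace by auto

lemma strongly_compact_imp_uniformly_inner_regular:
  fixes X :: "'a::metric_space set"
  assumes X: "compact X" and rc: "relatively_compact_in (strong_topology X) (range \<mu>)"
    and A: "A \<in> sets (restrict_space borel X)"
  shows "uniformly_inner_regular \<mu> A"
  unfolding uniformly_inner_regular_def
proof (intro allI impI)
  fix e :: real assume e: "e > 0"
  let ?T = "strong_topology X"
  let ?M = "?T closure_of range \<mu>"
  have M: "?M \<subseteq> borel_probs X"
    using closure_of_subset_topspace[of ?T "range \<mu>"]
    unfolding strong_topology_def using topspace_initial_topology_subset by (rule order_trans)
  have \<mu>: "\<mu> n \<in> ?M" for n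
    using rc closure_of_subset[of "range \<mu>" ?T] unfolding relatively_compact_in_def by blast
  have "\<exists>K. compact K \<and> K \<subseteq> A \<and> measure \<nu> (A - K) < e" if "\<nu> \<in> ?M" for \<nu>
    by (rule borel_probs_inner_regular[OF X _ A e, of \<nu>]) (use M that in auto)
  then obtain K where K: "\<And>\<nu>. \<nu> \<in> ?M \<Longrightarrow> compact (K \<nu>)" "\<And>\<nu>. \<nu> \<in> ?M \<Longrightarrow> K \<nu> \<subseteq> A"
    "\<And>\<nu>. \<nu> \<in> ?M \<Longrightarrow> measure \<nu> (A - K \<nu>) < e" by metis
  have cl: "C \<in> sets (restrict_space borel X)" if "compact C" "C \<subseteq> A" for C
  proof -
    have "C \<subseteq> X" using that(2) A by (auto simp: sets_restrict_space)
    then show ?thesis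
      using sets_restrict_borel_closedin[of X C] closedin_compact_eq[OF X, of C] that(1) by simp
  qed
  \<comment> \<open>\<open>U \<nu>\<close> is defined by evaluation at the single Borel set
    \<open>A - K \<nu>\<close>, so it is strongly open, and \<open>K \<nu>\<close> works for each of
    its members.\<close>
  define U where "U \<nu> = {m \<in> borel_probs X. measure m (A - K \<nu>) \<in> {..<e}}" for \<nu>
  have "openin ?T (U \<nu>)" if "\<nu> \<in> ?M" for \<nu>
  proof -
    have "A - K \<nu> \<in> sets (restrict_space borel X)" using A cl K that by blast
    then show ?thesis
      unfolding strong_topology_def initial_topology_def U_def
      by (intro topology_generated_by_Basis) (auto intro!: exI[of _ "\<lambda>m. measure m (A - K \<nu>)"] exI[of _ "{..<e}"])
  qed
  moreover have "?M \<subseteq> \<Union>(U ` ?M)" using K(3) M unfolding U_def by blast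
  moreover have "compactin ?T ?M" using rc unfolding relatively_compact_in_def by blast
  ultimately obtain F where F: "finite F" "F \<subseteq> U ` ?M" "?M \<subseteq> \<Union>F"
    using compactinD[of ?T ?M "U ` ?M"] by auto
  obtain I where I: "finite I" "I \<subseteq> ?M" "F = U ` I"
    using finite_subset_image[OF F(1,2)] by auto
  let ?K = "\<Union>\<nu>\<in>I. K \<nu>"
  have Kc: "compact ?K" using I K(1) by (intro compact_UN) auto
  have KA: "?K \<subseteq> A" using I(2) K(2) by blast
  have "measure (\<mu> n) (A - ?K) \<le> e" for n
  proof -
    have n: "\<mu> n \<in> borel_probs X" using M \<mu> by blast
    interpret prob_space "\<mu> n" by (rule borel_probsD(1)[OF n])
    obtain \<nu> where \<nu>: "\<nu> \<in> I" "\<mu> n \<in> U \<nu>" using F(3) I(3) \<mu> by blast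
    have "A - K \<nu> \<in> events"
      using A cl[of "K \<nu>"] K I(2) \<nu>(1) borel_probsD(2)[OF n] by (auto intro!: sets.Diff)
    then have "measure (\<mu> n) (A - ?K) \<le> measure (\<mu> n) (A - K \<nu>)"
      using \<nu>(1) by (intro finite_measure_mono) auto
    then show ?thesis using \<nu>(2) by (simp add: U_def)
  qed
  then show "\<exists>K. compact K \<and> K \<subseteq> A \<and> (\<forall>n. measure (\<mu> n) (A - K) \<le> e)" using Kc KA by blast
qed

section \<open>Partitions with null frontiers and the four conditions\<close>

lemma weak_limits_subset: "weak_limits X \<mu> \<subseteq> borel_probs X"
proof -
  have "weak_limits X \<mu> \<subseteq> topspace (weak_star_topology X)"
    unfolding weak_limits_def limit_points_seq_def by blast
  also have "\<dots> \<subseteq> borel_probs X"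
    unfolding weak_star_topology_def by (rule topspace_initial_topology_subset)
  finally show ?thesis .
qed

lemma finite_null_points:
  assumes "prob_space \<nu>" "finite S" "\<And>x. x \<in> S \<Longrightarrow> {x} \<in> sets \<nu>" "\<And>x. x \<in> S \<Longrightarrow> measure \<nu> {x} = 0"
  shows "measure \<nu> S = 0"
proof -
  interpret prob_space \<nu> by fact
  have "measure \<nu> S = (\<Sum>x\<in>S. measure \<nu> {x})"
    using assms(2,3) by (intro finite_measure_eq_sum_singleton) auto
  then show ?thesis using assms(4) by simp
qed

lemma small_frontiers_imp_null_partition:
  fixes X :: "'a::metric_space set"
  assumes X: "compact X" and sf: "small_frontiers (top_of_set X) D" and \<alpha>: "\<alpha> > 0"
    and null: "\<And>x \<nu>. x \<in> D \<Longrightarrow> \<nu> \<in> weak_limits X \<mu> \<Longrightarrow> measure \<nu> {x} = 0"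
  shows "\<exists>Q. finite_borel_partition X Q \<and> (\<forall>A\<in>Q. diameter A < \<alpha>) \<and>
           (\<forall>A\<in>Q. \<forall>\<nu>\<in>weak_limits X \<mu>. measure \<nu> (top_of_set X frontier_of A) = 0)"
proof -
  \<comment> \<open>The negligible frontiers are the finite subsets of \<open>D\<close>: a weak*
    limit that gives no mass to the points of \<open>D\<close> gives none to these.\<close>
  define N where "N S \<longleftrightarrow> finite S \<and> S \<subseteq> D" for S :: "'a set"
  have "\<exists>Q. finite_borel_partition X Q \<and> (\<forall>A\<in>Q. diameter A < \<alpha>) \<and>
           (\<forall>A\<in>Q. N (top_of_set X frontier_of A))"
    using sf unfolding small_frontiers_def N_def
    by (intro partition_from_small_neighbourhoods X \<alpha>) (auto intro: finite_subset)
  then obtain Q where Q: "finite_borel_partition X Q" "\<forall>A\<in>Q. diameter A < \<alpha>"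
    "\<And>A. A \<in> Q \<Longrightarrow> N (top_of_set X frontier_of A)" by blast
  have "measure \<nu> (top_of_set X frontier_of A) = 0" if A: "A \<in> Q" and \<nu>: "\<nu> \<in> weak_limits X \<mu>" for A \<nu>
  proof (rule finite_null_points)
    have b: "\<nu> \<in> borel_probs X" using \<nu> weak_limits_subset by blast
    show "prob_space \<nu>" using b by (rule borel_probsD)
    show "finite (top_of_set X frontier_of A)" using Q(3)[OF A] N_def by blast
    fix x assume x: "x \<in> top_of_set X frontier_of A"
    then have "x \<in> X" using frontier_of_subset_topspace[of "top_of_set X" A] by auto
    then have "closedin (top_of_set X) {x}" by (simp add: closed_subset)
    then show "{x} \<in> sets \<nu>" using sets_restrict_borel_closedin borel_probsD(2)[OF b] by blast
    show "measure \<nu> {x} = 0" using null[OF _ \<nu>] x Q(3)[OF A] N_def by blast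
  qed
  then show ?thesis using Q by blast
qed

theorem theorem3p8:
  fixes X :: "'a::metric_space set"
    and f :: "nat \<Rightarrow> 'a \<Rightarrow> 'a"
    and \<mu> :: "nat \<Rightarrow> 'a measure"
  assumes "topological_NDS X f"
    and "IMS X f \<mu>"
    and "relatively_compact_in (strong_topology X) (range \<mu>)
      \<or> (\<forall>\<alpha>>0. \<exists>Q. finite_borel_partition X Q \<and> (\<forall>A\<in>Q. diameter A < \<alpha>) \<and>
           (\<forall>A\<in>Q. \<forall>\<nu>\<in>weak_limits X \<mu>. measure \<nu> (top_of_set X frontier_of A) = 0))
      \<or> zero_dimensional (top_of_set X)
      \<or> (unit_interval_space X \<or> circle_space X) \<and>
          (\<exists>D\<subseteq>X. X \<subseteq> closure D \<and> (\<forall>x\<in>D. \<forall>\<nu>\<in>weak_limits X \<mu>. measure \<nu> {x} = 0))"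
  shows "\<exists>P. fine_scale_sequence X \<mu> P \<and> (\<forall>k. \<exists>Q. \<forall>n. P k n = Q)"
proof -
  have X: "compact X" "X \<noteq> {}" using assms(1) unfolding topological_NDS_def by auto
  have \<mu>: "\<mu> n \<in> borel_probs X" for n using assms(2) unfolding IMS_def by blast
  have regular: "uniformly_inner_regular \<mu> A"
    if "finite_borel_partition X Q" "A \<in> Q"
      "\<forall>A\<in>Q. \<forall>\<nu>\<in>weak_limits X \<mu>. measure \<nu> (top_of_set X frontier_of A) = 0" for Q A
  proof (rule null_frontier_imp_uniformly_inner_regular[OF X(1) \<mu>])
    show "A \<in> sets (restrict_space borel X)"
      using that(1,2) unfolding finite_borel_partition_def by blast
  qed (use that in blast)
  show ?thesis
  proof (rule constant_fine_scale_sequence[OF X])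
    fix \<alpha> :: real assume \<alpha>: "\<alpha> > 0"
    note null_partition = small_frontiers_imp_null_partition[OF X(1) _ \<alpha>]
    \<comment> \<open>Every condition other than (i) is reduced to a partition with null frontiers
      at the given scale.\<close>
    consider "relatively_compact_in (strong_topology X) (range \<mu>)"
      | (null) "\<exists>Q. finite_borel_partition X Q \<and> (\<forall>A\<in>Q. diameter A < \<alpha>) \<and>
           (\<forall>A\<in>Q. \<forall>\<nu>\<in>weak_limits X \<mu>. measure \<nu> (top_of_set X frontier_of A) = 0)"
      using assms(3)
    proof (elim disjE)
      assume "zero_dimensional (top_of_set X)"
      \<comment> \<open>Clopen neighbourhoods have empty frontier, so the empty set serves as
        \<open>D\<close> and the nullity requirement is vacuous.\<close>
      then show ?thesis
        using null_partition[OF small_frontiers_zero_dimensional, of "{}" \<mu>] that(2) by blast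
    next
      assume "(unit_interval_space X \<or> circle_space X) \<and>
          (\<exists>D\<subseteq>X. X \<subseteq> closure D \<and> (\<forall>x\<in>D. \<forall>\<nu>\<in>weak_limits X \<mu>. measure \<nu> {x} = 0))"
      then obtain D where D: "small_frontiers (top_of_set X) D"
          "\<And>x \<nu>. x \<in> D \<Longrightarrow> \<nu> \<in> weak_limits X \<mu> \<Longrightarrow> measure \<nu> {x} = 0"
        using small_frontiers_interval_or_circle[OF X(1)] by blast
      show ?thesis by (rule that(2)[OF null_partition[OF D]])
    qed (use \<alpha> that in blast)+
    then show "\<exists>Q. finite_borel_partition X Q \<and> (\<forall>A\<in>Q. diameter A \<le> \<alpha>) \<and>
              (\<forall>A\<in>Q. uniformly_inner_regular \<mu> A)"
    proof cases
      case 1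
      \<comment> \<open>Under (i) every Borel set is uniformly inner regular, so only the mesh
        matters and all frontiers count as negligible.\<close>
      obtain Q where Q: "finite_borel_partition X Q" "\<forall>A\<in>Q. diameter A < \<alpha>"
        using partition_from_small_neighbourhoods[OF X(1) \<alpha>, of "\<lambda>_. True"] by blast
      then show ?thesis
        using strongly_compact_imp_uniformly_inner_regular[OF X(1) 1] less_imp_le
        unfolding finite_borel_partition_def by blast
    next
      case null
      then show ?thesis using regular less_imp_le by blast
    qed
  qed
qed

end
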